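(* Let $n,m,k\ge1$ be integers, let $\Omega=\{\omega_1,\dots,\omega_k\}$ be a set of basis input functions of the form described in the context, with $\ell_{\max}=\max\{\ell_1,\dots,\ell_k\}$, and let $\mathcal{C}_{m,1}$ be the sign system concept class with scalar observations. Then $$\mathrm{VC}(\mathcal{C}_{m,1})\le 2(2mn^2+4n+1)\log_2\Big[8e\big(8mn^2k(n+\ell_{\max})+1\big)\big(2nk+2(1+2k)^n\big)\Big].$$
   Context: Basis input functions: $\omega_1,\dots,\omega_k:[0,1]\to\mathbb{R}$ are linearly independent, and for each $j$ either $\omega_j(t)=t^{\ell_j}e^{\alpha_j t}\sin(\beta_j t)$ or $\omega_j(t)=t^{\ell_j}e^{\alpha_j t}\cos(\beta_j t)$ with $\ell_j\in\{0,1,2,\dots\}$ and $\alpha_j,\beta_j\in\mathbb{R}$. Put $\omega=(\omega_1,\dots,\omega_k)^T$. Systems: a linear system $\Sigma=(A,B,C,x^0)$ of dimension $n$ with $m$ inputs and scalar output is $\dot x=Ax+Bu$, $x(0)=x^0$, $y=Cx$ on $[0,1]$, with $A,B,C$ real matrices of sizes $n\times n$, $n\times m$, $1\times n$ and $x^0\in\mathbb{R}^n$. Let $X_\Omega=\{G\omega:[0,1]\to\mathbb{R}^m : G\in\mathbb{R}^{m\times k}\}$. Let $S_\Sigma:X_\Omega\to\{0,1\}$ be $S_\Sigma(G\omega)=\mathrm{sign}(y(1))$, where $y(1)$ is the final output of $\Sigma$ under control $u=G\omega$, and $\mathrm{sign}\,z=1$ if $z>0$, $\mathrm{sign}\,z=0$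 if $z\le0$. The sign system concept class is $\mathcal{C}_{m,1}=\{S_\Sigma:\Sigma\text{ a linear system of dimension }n\}$. VC-dimension: for a class $\mathcal{C}$ of maps $X\to\{0,1\}$, a set $D\subseteq X$ is shattered if every map $D\to\{0,1\}$ is the restriction to $D$ of some element of $\mathcal{C}$; $\mathrm{VC}(\mathcal{C})$ is the largest cardinality of a shattered set. *)

theory Defs
  imports "HOL-Analysis.Analysis"
begin

text \<open>
  Functions on \<open>[0,1]\<close> are elements of \<open>extensional {0..1}\<close>, so that equality of inputs means
  equality on \<open>[0,1]\<close>; likewise concepts are extensional on the input space.
\<close>

definition basis_inputs ::
  "('k::finite \<Rightarrow> nat) \<Rightarrow> ('k \<Rightarrow> real) \<Rightarrow> ('k \<Rightarrow> real) \<Rightarrow> ('k \<Rightarrow> real \<Rightarrow> real) \<Rightarrow> bool" where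
  "basis_inputs l \<alpha> \<beta> \<omega> \<longleftrightarrow>
     (\<forall>j. \<omega> j = (\<lambda>t\<in>{0..1}. t ^ l j * exp (\<alpha> j * t) * sin (\<beta> j * t)) \<or>
          \<omega> j = (\<lambda>t\<in>{0..1}. t ^ l j * exp (\<alpha> j * t) * cos (\<beta> j * t))) \<and>
     (\<forall>c::'k \<Rightarrow> real. (\<forall>t\<in>{0..1}. (\<Sum>j\<in>UNIV. c j * \<omega> j t) = 0) \<longrightarrow> (\<forall>j. c j = 0))"

definition input_space ::
  "('k::finite \<Rightarrow> real \<Rightarrow> real) \<Rightarrow> (real \<Rightarrow> real^'m::finite) set" where
  "input_space \<omega> = {\<lambda>t\<in>{0..1}. G *v (\<chi> j. \<omega> j t) | G :: real^'k^'m. True}"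

definition is_trajectory ::
  "real^'n^'n \<Rightarrow> real^'m^'n \<Rightarrow> real^'n \<Rightarrow> (real \<Rightarrow> real^'m) \<Rightarrow> (real \<Rightarrow> real^'n) \<Rightarrow> bool" where
  "is_trajectory A B x0 u x \<longleftrightarrow>
     x 0 = x0 \<and>
     (\<forall>t\<in>{0..1}. (x has_vector_derivative (A *v x t + B *v u t)) (at t within {0..1}))"

text \<open>
  The description is well defined for continuous \<open>u\<close>, in particular on the input space: there the
  initial value problem has exactly one solution on \<open>[0,1]\<close>.
\<close>

definition final_output ::
  "real^'n^'n \<Rightarrow> real^'m^'n \<Rightarrow> real^'n^1 \<Rightarrow> real^'n \<Rightarrow> (real \<Rightarrow> real^'m) \<Rightarrow> real" where
  "final_output A B C x0 u = (THE y. \<exists>x. is_trajectory A B x0 u x \<and> y = (C *v x 1) $ 1)"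

definition sign01 :: "real \<Rightarrow> nat" where
  "sign01 z = (if z > 0 then 1 else 0)"

definition sign_system ::
  "('k::finite \<Rightarrow> real \<Rightarrow> real) \<Rightarrow> real^'n^'n \<Rightarrow> real^'m^'n \<Rightarrow> real^'n^1 \<Rightarrow> real^'n \<Rightarrow>
     (real \<Rightarrow> real^'m) \<Rightarrow> nat" where
  "sign_system \<omega> A B C x0 = (\<lambda>u\<in>input_space \<omega>. sign01 (final_output A B C x0 u))"

text \<open>The type argument carries the state dimension, which is \<open>CARD('n)\<close>.\<close>

definition sign_concept_class ::
  "'n::finite itself \<Rightarrow> ('k::finite \<Rightarrow> real \<Rightarrow> real) \<Rightarrow> ((real \<Rightarrow> real^'m::finite) \<Rightarrow> nat) set" where
  "sign_concept_class _ \<omega> =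
     {sign_system \<omega> A B C x0 |
        (A :: real^'n^'n) (B :: real^'m^'n) (C :: real^'n^1) (x0 :: real^'n). True}"

definition shattered :: "('a \<Rightarrow> nat) set \<Rightarrow> 'a set \<Rightarrow> bool" where
  "shattered \<C> D \<longleftrightarrow> (\<forall>f \<in> D \<rightarrow> {0, 1}. \<exists>c\<in>\<C>. \<forall>u\<in>D. c u = f u)"

definition vc_dim :: "'a set \<Rightarrow> ('a \<Rightarrow> nat) set \<Rightarrow> enat" where
  "vc_dim X \<C> =
     (SUP D \<in> {D. D \<subseteq> X \<and> shattered \<C> D}. if finite D then enat (card D) else \<infinity>)"

end

theory Submission
  imports Defs
begin

text \<open>
  If a class shatters \<open>N\<close> inputs, then all \<open>2\<^sup>N\<close> sign vectors occur among the values of the \<open>N\<close>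
  functions that send a system to its final output under the given inputs. The proof writes these
  functions, up to a common positive factor, as polynomials of bounded degree in few parameters, and
  bounds the number of sign vectors that such polynomials can produce.

  \<^emph>\<open>Polynomial outputs.\<close> Let \<open>E = exp A\<close>. The final output is \<open>C E x\<^sup>0 + \<Sum>\<^sub>j C Y\<^sub>j\<close>, where
  \<open>Y\<^sub>j = \<integral>\<^sub>0\<^sup>1 \<omega>\<^sub>j(s) exp((1 - s)A) v\<^sub>j ds\<close> and \<open>v\<^sub>j\<close> is the image under \<open>B\<close> of the \<open>j\<close>-th column of
  \<open>G\<close>. Integration by parts gives linear equations for the vectors \<open>Y\<close> that belong to
  \<open>t\<^sup>l e\<^sup>\<alpha>\<^sup>t cos \<beta>t\<close> and \<open>t\<^sup>l e\<^sup>\<alpha>\<^sup>t sin \<beta>t\<close>; their matrix is \<open>(A - \<alpha>)\<^sup>2 + \<beta>\<^sup>2\<close>, and Cramer's rule,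
  iterated over \<open>l\<close>, shows that the \<open>(l + 1)\<close>-st power of its determinant times \<open>Y\<close> is polynomial in
  \<open>A\<close>, \<open>E\<close> and \<open>B\<close>. So the outputs become polynomials in the entries of \<open>A\<close>, \<open>E\<close>, \<open>B\<close>, \<open>C\<close> and in
  \<open>c = C E x\<^sup>0\<close> (\<open>output_polynomial\<close>), where \<open>E\<close> may be regarded as a matrix independent of \<open>A\<close>:
  more parameter values only help to realise sign vectors. There are \<open>2n\<^sup>2 + nm + n + 1\<close> parameters.
  The determinants vanish for exceptional \<open>A\<close>, but finitely many strict inequalities survive a small
  change of \<open>c\<close> and the replacement of \<open>A\<close> by \<open>A + \<epsilon>\<close>, and for all small \<open>\<epsilon> \<noteq> 0\<close> the determinants
  are nonzero.

  \<^emph>\<open>Sign vectors of polynomials.\<close> If \<open>N\<close> polynomials of degree at most \<open>d\<close> in \<open>p\<close> variables realise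
  all \<open>2\<^sup>N\<close> strict sign vectors, then \<open>2\<^sup>N \<le> (Nd + 2)\<^sup>p\<close> (\<open>sign_pattern_bound\<close>). Let \<open>F\<close> be their
  product. On each cell, \<open>|F| exp(a \<bullet> x - |x|\<^sup>2/2)\<close> has a maximum, and there
  \<open>a\<^sub>i = (x\<^sub>i F - \<partial>\<^sub>i F)/F\<close>: the same \<open>p\<close> equations have a solution in every cell, for every \<open>a\<close>. A
  count of monomials yields a nontrivial polynomial relation between the \<open>p\<close> rational functions on
  the right and one further linear form, of degree at most \<open>(Nd + 2)\<^sup>p\<close> in the latter. For suitable
  \<open>a\<close> it does not degenerate when \<open>a\<close> is substituted, and for a suitable linear form the chosen
  points of the \<open>2\<^sup>N\<close> cells then give \<open>2\<^sup>N\<close> different roots of one univariate polynomial. This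
  elementary argument replaces the theorem of Bezout and the bounds for the topology of real
  varieties; the estimate so obtained, with the parameter count above, is sharp enough for the bound
  asserted below.
\<close>

section \<open>Polynomial functions in several variables\<close>

text \<open>
  \<open>polyfn d f\<close>: the function \<open>f\<close> on \<open>real ^ 'p\<close> is a polynomial of total degree at most \<open>d\<close>. The
  inductive form makes degree bounds for composite expressions a matter of applying the introduction
  rules.
\<close>

inductive polyfn :: "nat \<Rightarrow> (real^'p::finite \<Rightarrow> real) \<Rightarrow> bool" where
  polyfn_const: "polyfn d (\<lambda>x. c)"
| polyfn_var: "1 \<le> d \<Longrightarrow> polyfn d (\<lambda>x. x $ i)"
| polyfn_add: "polyfn d f \<Longrightarrow> polyfn d g \<Longrightarrow> polyfn d (\<lambda>x. f x + g x)"
| polyfn_mult: "polyfn d f \<Longrightarrow> polyfn e g \<Longrightarrow> d + e \<le> b \<Longrightarrow> polyfn b (\<lambda>x. f x * g x)"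

lemma polyfn_mono: "polyfn d f \<Longrightarrow> (\<And>e. d \<le> e \<Longrightarrow> polyfn e f)"
proof (induction rule: polyfn.induct)
  case (polyfn_mult d f e' g b)
  then show ?case by (intro polyfn.polyfn_mult[of d f e' g e]) auto
qed (auto intro: polyfn.intros)

lemma polyfn_cmult: "polyfn d f \<Longrightarrow> polyfn d (\<lambda>x. c * f x)"
  using polyfn_mult[OF polyfn_const[of 0]] by auto

lemma polyfn_uminus: "polyfn d f \<Longrightarrow> polyfn d (\<lambda>x. - f x)"
  using polyfn_cmult[of d f "-1"] by simp

lemma polyfn_diff: "polyfn d f \<Longrightarrow> polyfn d g \<Longrightarrow> polyfn d (\<lambda>x. f x - g x)"
  using polyfn_add[OF _ polyfn_uminus] by fastforce

lemma polyfn_sum: "(\<And>i. i \<in> I \<Longrightarrow> polyfn d (f i)) \<Longrightarrow> polyfn d (\<lambda>x. \<Sum>i\<in>I. f i x)"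
  by (induction I rule: infinite_finite_induct) (auto intro: polyfn_const polyfn_add)

lemma polyfn_prod:
  "(\<And>i. i \<in> I \<Longrightarrow> polyfn (d i) (f i)) \<Longrightarrow> polyfn (\<Sum>i\<in>I. d i) (\<lambda>x. \<Prod>i\<in>I. f i x)"
proof (induction I rule: infinite_finite_induct)
  case (insert j I)
  then have "polyfn (\<Sum>i\<in>insert j I. d i) (\<lambda>x. f j x * (\<Prod>i\<in>I. f i x))"
    by (intro polyfn_mult[of "d j" _ "\<Sum>i\<in>I. d i"]) auto
  then show ?case using insert.hyps by simp
qed (auto intro: polyfn_const)

lemma polyfn_power: "polyfn d f \<Longrightarrow> polyfn (k * d) (\<lambda>x. f x ^ k)"
proof (induction k)
  case (Suc k)
  then have "polyfn (Suc k * d) (\<lambda>x. f x * f x ^ k)"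
    by (intro polyfn_mult[of d _ "k * d"]) auto
  then show ?case by simp
qed (auto intro: polyfn_const)

lemma polyfn_has_derivative:
  fixes f :: "real^'p::finite \<Rightarrow> real"
  assumes "polyfn d f"
  shows "\<exists>f'. (\<forall>i. polyfn d (f' i)) \<and>
           (\<forall>x. (f has_derivative (\<lambda>h. \<Sum>i\<in>UNIV. h $ i * f' i x)) (at x))"
  using assms
proof (induction rule: polyfn.induct)
  case (polyfn_const d c)
  then show ?case by (intro exI[of _ "\<lambda>_ _. 0"]) (auto intro: polyfn.polyfn_const)
next
  case (polyfn_var d j)
  have "((\<lambda>x. x $ j) has_derivative (\<lambda>h. \<Sum>i\<in>UNIV. h $ i * (if i = j then 1 else 0))) (at x)"
    for x :: "real^'p"
  proof -
    have "(\<Sum>i\<in>UNIV. h $ i * (if i = j then 1 else 0)) = h $ j" for h :: "real^'p"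
      by (subst sum.remove[of _ j]) auto
    then show ?thesis by (simp add: bounded_linear_imp_has_derivative bounded_linear_vec_nth)
  qed
  then show ?case
    by (intro exI[of _ "\<lambda>i _. if i = j then 1 else 0"]) (auto intro: polyfn.polyfn_const)
next
  case (polyfn_add d f g)
  then obtain f' g' where
    *: "\<And>i. polyfn d (f' i)" "\<And>x. (f has_derivative (\<lambda>h. \<Sum>i\<in>UNIV. h $ i * f' i x)) (at x)"
    "\<And>i. polyfn d (g' i)" "\<And>x. (g has_derivative (\<lambda>h. \<Sum>i\<in>UNIV. h $ i * g' i x)) (at x)"
    by blast
  have "((\<lambda>x. f x + g x) has_derivative (\<lambda>h. \<Sum>i\<in>UNIV. h $ i * (f' i x + g' i x))) (at x)" for x
    using has_derivative_add[OF *(2,4), of x] by (simp add: algebra_simps sum.distrib)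
  with * show ?case
    by (intro exI[of _ "\<lambda>i x. f' i x + g' i x"] conjI allI polyfn.polyfn_add) auto
next
  case (polyfn_mult d f e g b)
  then obtain f' g' where
    *: "\<And>i. polyfn d (f' i)" "\<And>x. (f has_derivative (\<lambda>h. \<Sum>i\<in>UNIV. h $ i * f' i x)) (at x)"
    "\<And>i. polyfn e (g' i)" "\<And>x. (g has_derivative (\<lambda>h. \<Sum>i\<in>UNIV. h $ i * g' i x)) (at x)"
    by blast
  have "((\<lambda>x. f x * g x) has_derivative (\<lambda>h. \<Sum>i\<in>UNIV. h $ i * (f x * g' i x + f' i x * g x))) (at x)" for x
    using has_derivative_mult[OF *(2,4), of x]
    by (simp add: algebra_simps sum.distrib sum_distrib_left)
  moreover have "polyfn b (\<lambda>x. f x * g' i x + f' i x * g x)" for i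
    by (intro polyfn.polyfn_add polyfn.polyfn_mult[OF _ _ polyfn_mult.hyps(3)] * polyfn_mult.hyps)
  ultimately show ?case by (intro exI[of _ "\<lambda>i x. f x * g' i x + f' i x * g x"]) auto
qed

lemma polyfn_continuous_on: "polyfn d f \<Longrightarrow> continuous_on S f"
  by (induction rule: polyfn.induct) (intro continuous_intros; assumption)+

lemma polyfn_growth:
  assumes "polyfn d f"
  shows "\<exists>C. \<forall>x. \<bar>f x\<bar> \<le> C * (1 + norm x) ^ d"
  using assms
proof (induction rule: polyfn.induct)
  case (polyfn_const d c)
  have "\<bar>c\<bar> * 1 \<le> \<bar>c\<bar> * (1 + norm x) ^ d" for x :: "real^'a"
    by (intro mult_left_mono one_le_power) auto
  then show ?case by auto
next
  case (polyfn_var d i)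
  have "\<bar>x $ i\<bar> \<le> 1 * (1 + norm x) ^ d" for x :: "real^'a"
  proof -
    have "\<bar>x $ i\<bar> \<le> (1 + norm x) ^ 1" using component_le_norm_cart[of x i] by simp
    also have "\<dots> \<le> (1 + norm x) ^ d" using polyfn_var by (intro power_increasing) auto
    finally show ?thesis by simp
  qed
  then show ?case by blast
next
  case (polyfn_add d f g)
  obtain C where C1: "\<forall>x. \<bar>f x\<bar> \<le> C * (1 + norm x) ^ d"
    using polyfn_add.IH(1) ..
  obtain C' where C2: "\<forall>x. \<bar>g x\<bar> \<le> C' * (1 + norm x) ^ d"
    using polyfn_add.IH(2) ..
  have "\<bar>f x + g x\<bar> \<le> (C + C') * (1 + norm x) ^ d" for x
    using C1[rule_format, of x] C2[rule_format, of x] by (simp add: distrib_right)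
  then show ?case by blast
next
  case (polyfn_mult d f e g b)
  obtain C where C1: "\<forall>x. \<bar>f x\<bar> \<le> C * (1 + norm x) ^ d"
    using polyfn_mult.IH(1) ..
  obtain C' where C2: "\<forall>x. \<bar>g x\<bar> \<le> C' * (1 + norm x) ^ e"
    using polyfn_mult.IH(2) ..
  have "0 \<le> \<bar>f 0\<bar>" "0 \<le> \<bar>g 0\<bar>" by auto
  then have nn: "0 \<le> C" "0 \<le> C'" using C1[rule_format, of 0] C2[rule_format, of 0] by auto
  have "\<bar>f x * g x\<bar> \<le> (C * C') * (1 + norm x) ^ b" for x
  proof -
    have "\<bar>f x * g x\<bar> \<le> (C * (1 + norm x) ^ d) * (C' * (1 + norm x) ^ e)"
      unfolding abs_mult by (intro mult_mono C1[rule_format] C2[rule_format]) (use nn in auto)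
    also have "\<dots> = (C * C') * (1 + norm x) ^ (d + e)" by (simp add: power_add)
    also have "\<dots> \<le> (C * C') * (1 + norm x) ^ b"
      using polyfn_mult nn by (intro mult_left_mono power_increasing) auto
    finally show ?thesis .
  qed
  then show ?case by blast
qed

text \<open>Exponent vectors of total degree at most \<open>d\<close>.\<close>

definition expvecs :: "nat \<Rightarrow> ('p::finite \<Rightarrow> nat) set" where
  "expvecs d = {a. (\<Sum>i\<in>UNIV. a i) \<le> d}"

text \<open>The monomial with exponent vector \<open>a\<close>.\<close>

definition monomial :: "('p::finite \<Rightarrow> nat) \<Rightarrow> real^'p \<Rightarrow> real" where
  "monomial a x = (\<Prod>i\<in>UNIV. (x $ i) ^ a i)"

lemma expvecs_le: "a \<in> expvecs d \<Longrightarrow> a i \<le> d"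
  unfolding expvecs_def using member_le_sum[of i UNIV a] by auto

lemma finite_expvecs [simp]: "finite (expvecs d :: ('p::finite \<Rightarrow> nat) set)"
proof (rule finite_subset)
  show "(expvecs d :: ('p \<Rightarrow> nat) set) \<subseteq> (UNIV \<rightarrow>\<^sub>E {..d})" using expvecs_le by (auto simp: PiE_def)
  show "finite ((UNIV :: 'p set) \<rightarrow>\<^sub>E {..d})" by (intro finite_PiE) auto
qed

lemma zero_in_expvecs: "(\<lambda>_. 0) \<in> expvecs d"
  by (simp add: expvecs_def)

lemma monomial_mult: "monomial a x * monomial b x = monomial (\<lambda>i. a i + b i) x"
  by (simp add: monomial_def power_add prod.distrib)

text \<open>Linear combinations of monomials of degree at most \<open>d\<close>.\<close>

definition monomial_comb :: "nat \<Rightarrow> (real^'p::finite \<Rightarrow> real) \<Rightarrow> bool" where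
  "monomial_comb d f \<longleftrightarrow> (\<exists>c. \<forall>x. f x = (\<Sum>a\<in>expvecs d. c a * monomial a x))"

lemma monomial_comb_monomial: 
  assumes "b \<in> expvecs d" shows "monomial_comb d (\<lambda>x. r * monomial b x)"
  unfolding monomial_comb_def
proof (intro exI[of _ "\<lambda>a. if a = b then r else 0"] allI)
  fix x :: "real^'a"
  have "(\<Sum>a\<in>expvecs d. (if a = b then r else 0) * monomial a x) = 
      (\<Sum>a\<in>expvecs d. if a = b then r * monomial a x else 0)" by (intro sum.cong) auto
  then show "r * monomial b x = (\<Sum>a\<in>expvecs d. (if a = b then r else 0) * monomial a x)"
    using assms by (simp add: sum.delta)
qed

lemma monomial_comb_add: "monomial_comb d f \<Longrightarrow> monomial_comb d g \<Longrightarrow> monomial_comb d (\<lambda>x. f x + g x)"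
  unfolding monomial_comb_def
proof (elim exE)
  fix c c' assume "\<forall>x. f x = (\<Sum>a\<in>expvecs d. c a * monomial a x)"
    "\<forall>x. g x = (\<Sum>a\<in>expvecs d. c' a * monomial a x)"
  then show "\<exists>c. \<forall>x. f x + g x = (\<Sum>a\<in>expvecs d. c a * monomial a x)"
    by (intro exI[of _ "\<lambda>a. c a + c' a"]) (simp add: algebra_simps sum.distrib)
qed

lemma monomial_comb_sum: "(\<And>i. i \<in> I \<Longrightarrow> monomial_comb d (f i)) \<Longrightarrow> monomial_comb d (\<lambda>x. \<Sum>i\<in>I. f i x)"
proof (induction I rule: infinite_finite_induct)
  case (insert i I)
  then show ?case by (auto intro: monomial_comb_add)
qed (auto simp: monomial_comb_def intro: exI[of _ "\<lambda>_. 0"])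

lemma polyfn_monomials:
  assumes "polyfn d f"
  shows "\<exists>c. \<forall>x. f x = (\<Sum>a\<in>expvecs d. c a * monomial a x)"
proof -
  have "monomial_comb d f"
    using assms
  proof (induction rule: polyfn.induct)
    case (polyfn_const d c)
    show ?case using monomial_comb_monomial[OF zero_in_expvecs, of d c] by (simp add: monomial_def)
  next
    case (polyfn_var d i)
    define b where "b = (\<lambda>j. if j = i then 1 else 0 :: nat)"
    have "b \<in> expvecs d" using polyfn_var by (simp add: expvecs_def b_def)
    moreover have "monomial b x = x $ i" for x :: "real^'a"
    proof -
      have "monomial b x = (\<Prod>j\<in>UNIV. if j = i then x $ j else 1)"
        unfolding monomial_def b_def by (intro prod.cong) auto
      then show ?thesis by simp
    qed
    ultimately show ?case using monomial_comb_monomial[of b d 1] by simp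
  next
    case (polyfn_add d f g)
    then show ?case by (auto intro: monomial_comb_add)
  next
    case (polyfn_mult d f e g b)
    then obtain c c' where c: "\<And>x. f x = (\<Sum>a\<in>expvecs d. c a * monomial a x)"
        "\<And>x. g x = (\<Sum>a\<in>expvecs e. c' a * monomial a x)"
      unfolding monomial_comb_def by blast
    have "monomial_comb b (\<lambda>x. \<Sum>a\<in>expvecs d. \<Sum>a'\<in>expvecs e. (c a * c' a') * monomial (\<lambda>i. a i + a' i) x)"
      using polyfn_mult.hyps by (intro monomial_comb_sum monomial_comb_monomial) (auto simp:
          expvecs_def sum.distrib)
    moreover have "(\<lambda>x. \<Sum>a\<in>expvecs d. \<Sum>a'\<in>expvecs e. (c a * c' a') * monomial (\<lambda>i. a i + a' i) x)
        = (\<lambda>x. f x * g x)"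
      unfolding c sum_product by (intro ext sum.cong) (simp_all add: monomial_mult[symmetric])
    ultimately show ?case by simp
  qed
  then show ?thesis unfolding monomial_comb_def .
qed

text \<open>A homogeneous linear system with more unknowns than equations has a nontrivial solution.\<close>

lemma homogeneous_system_nontrivial:
  fixes M :: "'i \<Rightarrow> 'j \<Rightarrow> real"
  assumes "finite J" "finite I" "card J < card I"
  shows "\<exists>x. (\<exists>i\<in>I. x i \<noteq> 0) \<and> (\<forall>j\<in>J. (\<Sum>i\<in>I. x i * M i j) = 0)"
  using assms
proof (induction J arbitrary: I M rule: finite_induct)
  case empty
  then obtain i where "i \<in> I" by (metis all_not_in_conv card.empty less_irrefl)
  then show ?case by (auto intro!: exI[of _ "\<lambda>_. 1"])
next
  case (insert j J)
  show ?case
  proof (cases "\<forall>i\<in>I. M i j = 0")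
    case True
    have "card J < card I" using insert by simp
    then obtain x where "\<exists>i\<in>I. x i \<noteq> 0" "\<forall>j\<in>J. (\<Sum>i\<in>I. x i * M i j) = 0"
      using insert.IH[OF insert.prems(1), of M] by blast
    then show ?thesis using True by auto
  next
    case False
    then obtain k where k: "k \<in> I" "M k j \<noteq> 0" by blast
    \<comment> \<open>eliminate the unknown \<open>k\<close> by means of equation \<open>j\<close>\<close>
    define M' where "M' i j' = M i j' - M i j / M k j * M k j'" for i j'
    have "finite (I - {k})" "card J < card (I - {k})" using insert k by auto
    then obtain x where x: "\<exists>i\<in>I - {k}. x i \<noteq> 0" "\<forall>j\<in>J. (\<Sum>i\<in>I - {k}. x i * M' i j) = 0"
      using insert.IH[of "I - {k}" M'] by blast
    define y where "y i = (if i = k then - (\<Sum>i\<in>I - {k}. x i * M i j) / M k j else x i)" for i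
    have split: "(\<Sum>i\<in>I. y i * M i j') = y k * M k j' + (\<Sum>i\<in>I - {k}. x i * M i j')" for j'
      using k insert.prems by (subst sum.remove[of I k]) (auto simp: y_def intro!: sum.cong)
    have "(\<Sum>i\<in>I. y i * M i j) = 0" unfolding split using k by (simp add: y_def)
    moreover have "(\<Sum>i\<in>I. y i * M i j') = 0" if "j' \<in> J" for j'
    proof -
      have "0 = (\<Sum>i\<in>I - {k}. x i * M' i j')" using x that by auto
      also have "\<dots> = (\<Sum>i\<in>I - {k}. x i * M i j') - (\<Sum>i\<in>I - {k}. x i * M i j) / M k j * M k j'"
        unfolding M'_def by (simp add: algebra_simps sum_subtractf sum_distrib_left sum_divide_distrib)
      finally show ?thesis unfolding split by (simp add: y_def)
    qed
    moreover have "\<exists>i\<in>I. y i \<noteq> 0" using x by (auto simp: y_def)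
    ultimately show ?thesis by auto
  qed
qed

lemma polyfn_dependent:
  fixes f :: "'i \<Rightarrow> real^'p::finite \<Rightarrow> real"
  assumes "finite I" "\<And>i. i \<in> I \<Longrightarrow> polyfn d (f i)"
    and "card (expvecs d :: ('p \<Rightarrow> nat) set) < card I"
  shows "\<exists>c. (\<exists>i\<in>I. c i \<noteq> 0) \<and> (\<forall>x. (\<Sum>i\<in>I. c i * f i x) = 0)"
proof -
  have "\<forall>i\<in>I. \<exists>M. \<forall>x. f i x = (\<Sum>a\<in>expvecs d. M a * monomial a x)"
    using polyfn_monomials assms(2) by blast
  then obtain M where M: "\<And>i x. i \<in> I \<Longrightarrow> f i x = (\<Sum>a\<in>expvecs d. M i a * monomial a x)"
    by metis
  obtain c where c: "\<exists>i\<in>I. c i \<noteq> 0" "\<And>a. a \<in> expvecs d \<Longrightarrow> (\<Sum>i\<in>I. c i * M i a) = 0"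
    using homogeneous_system_nontrivial[OF _ assms(1,3), of M] by auto
  have "(\<Sum>i\<in>I. c i * f i x) = 0" for x
  proof -
    have "(\<Sum>i\<in>I. c i * f i x) = (\<Sum>i\<in>I. \<Sum>a\<in>expvecs d. c i * M i a * monomial a x)"
      by (intro sum.cong) (auto simp: M sum_distrib_left mult.assoc)
    also have "\<dots> = (\<Sum>a\<in>expvecs d. (\<Sum>i\<in>I. c i * M i a) * monomial a x)"
      by (subst sum.swap) (simp add: sum_distrib_right)
    also have "\<dots> = 0" using c by simp
    finally show ?thesis .
  qed
  with c show ?thesis by blast
qed

text \<open>
  Division of exponents by \<open>m\<close> with remainder maps an exponent vector of degree \<open>T\<close> injectively to
  one of degree \<open>S\<close> together with a vector of residues. This comparison takes the place of exact
  binomial formulas for the number of monomials.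
\<close>

lemma card_expvecs_le:
  assumes "T \<le> m * S + (m - 1)" "0 < m"
  shows "card (expvecs T :: ('p::finite \<Rightarrow> nat) set) \<le> m ^ CARD('p) * card (expvecs S :: ('p \<Rightarrow> nat) set)"
proof -
  define h :: "('p \<Rightarrow> nat) \<Rightarrow> ('p \<Rightarrow> nat) \<times> ('p \<Rightarrow> nat)" where
    "h a = ((\<lambda>i. a i mod m), (\<lambda>i. a i div m))" for a
  have "inj_on h (expvecs T)"
  proof (rule inj_onI)
    fix a b assume "h a = h b"
    then have "a i mod m = b i mod m" "a i div m = b i div m" for i
      by (auto simp: h_def fun_eq_iff)
    then show "a = b" by (metis ext mult_div_mod_eq)
  qed
  moreover have "h ` expvecs T \<subseteq> (UNIV \<rightarrow>\<^sub>E {..<m}) \<times> expvecs S"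
  proof -
    have "(\<Sum>i\<in>UNIV. a i div m) \<le> S" if "a \<in> expvecs T" for a :: "'p \<Rightarrow> nat"
    proof -
      have "m * (\<Sum>i\<in>UNIV. a i div m) \<le> (\<Sum>i\<in>UNIV. a i)"
        unfolding sum_distrib_left by (intro sum_mono) (simp)
      also have "\<dots> \<le> m * S + (m - 1)" using that assms by (simp add: expvecs_def)
      also have "\<dots> < m * Suc S" using assms(2) by simp
      finally show ?thesis using assms(2) by (simp only: mult_less_cancel1) linarith
    qed
    then show ?thesis using assms(2) by (auto simp: h_def expvecs_def)
  qed
  moreover have "finite ((UNIV :: 'p set) \<rightarrow>\<^sub>E {..<m})" by (intro finite_PiE) auto
  ultimately have "card (expvecs T :: ('p \<Rightarrow> nat) set) \<le> card (((UNIV :: 'p set) \<rightarrow>\<^sub>E {..<m})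
      \<times> (expvecs S :: ('p \<Rightarrow> nat) set))"
    by (intro card_inj_on_le[of h]) auto
  also have "\<dots> = m ^ CARD('p) * card (expvecs S :: ('p \<Rightarrow> nat) set)"
    by (simp add: card_cartesian_product card_PiE)
  finally show ?thesis .
qed

section \<open>Counting strict sign vectors\<close>

lemma gaussian_decay:
  fixes b C \<epsilon> :: real
  assumes "0 < \<epsilon>"
  shows "\<exists>R\<ge>0. \<forall>r>R. C * (1 + r) ^ n * exp (b * r - r\<^sup>2) < \<epsilon>"
proof -
  have "filterlim (\<lambda>r::real. 1 + r) at_top at_top"
    by (rule filterlim_tendsto_add_at_top[OF tendsto_const filterlim_ident])
  from filterlim_compose[OF tendsto_power_div_exp_0[of n] this]
  have "((\<lambda>r. \<bar>C\<bar> * exp 1 * ((1 + r) ^ n / exp (1 + r))) \<longlongrightarrow> \<bar>C\<bar> * exp 1 * 0) at_top"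
    by (intro tendsto_mult_left) (simp add: o_def)
  then have "eventually (\<lambda>r. \<bar>C\<bar> * exp 1 * ((1 + r) ^ n / exp (1 + r)) < \<epsilon>) at_top"
    using assms by (intro order_tendstoD(2)) auto
  then obtain R where R: "\<And>r. r \<ge> R \<Longrightarrow> \<bar>C\<bar> * exp 1 * ((1 + r) ^ n / exp (1 + r)) < \<epsilon>"
    unfolding eventually_at_top_linorder by blast
  have "C * (1 + r) ^ n * exp (b * r - r\<^sup>2) < \<epsilon>" if r: "r > max R (\<bar>b\<bar> + 1)" for r
  proof -
    have "(b + 1) * r \<le> r * r" using r by (intro mult_right_mono) auto
    then have "exp (b * r - r\<^sup>2) \<le> exp (- r)" by (simp add: power2_eq_square algebra_simps)
    then have "C * (1 + r) ^ n * exp (b * r - r\<^sup>2) \<le> \<bar>C\<bar> * (1 + r) ^ n * exp (- r)"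
      using r by (intro mult_mono) auto
    also have "\<dots> = \<bar>C\<bar> * exp 1 * ((1 + r) ^ n / exp (1 + r))"
      by (simp add: exp_add exp_minus field_simps)
    also have "\<dots> < \<epsilon>" using R r by simp
    finally show ?thesis .
  qed
  then show ?thesis by (intro exI[of _ "max R (\<bar>b\<bar> + 1)"]) auto
qed

text \<open>
  On a closed region whose boundary lies in the zero set of \<open>F\<close>, the function
  \<open>|F| exp(a \<bullet> x - |x|\<^sup>2/2)\<close> attains its maximum, because the Gaussian factor beats the growth of
  \<open>F\<close>. The vanishing of the gradient there says that \<open>a\<close> is the value of the vector field
  \<open>x - \<nabla>F/F\<close>.
\<close>

lemma cell_critical_point:
  fixes F :: "real^'p::finite \<Rightarrow> real" and a :: "real^'p"
  assumes "polyfn d F"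
    and F': "\<And>x. (F has_derivative (\<lambda>h. \<Sum>i\<in>UNIV. h $ i * F' i x)) (at x)"
    and "closed K" "x0 \<in> K" "F x0 \<noteq> 0"
    and inner: "\<And>x. x \<in> K \<Longrightarrow> F x \<noteq> 0 \<Longrightarrow> x \<in> interior K"
  shows "\<exists>z\<in>K. F z \<noteq> 0 \<and> (\<forall>i. z $ i * F z - F' i z = a $ i * F z)"
proof -
  \<comment> \<open>the square of the function described above, in order to avoid the absolute value\<close>
  define H where "H x = F x * F x * exp (2 * (a \<bullet> x) - x \<bullet> x)" for x
  have H0: "0 < H x0" using assms by (auto simp: H_def zero_less_mult_iff)
  have "polyfn (d + d) (\<lambda>x. F x * F x)" by (rule polyfn_mult[OF assms(1,1)]) simp
  then obtain C where C: "\<And>x. \<bar>F x * F x\<bar> \<le> C * (1 + norm x) ^ (d + d)"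
    using polyfn_growth by blast
  obtain R where R: "R \<ge> 0" "\<And>r. r > R \<Longrightarrow> C * (1 + r) ^ (d + d) * exp (2 * norm a * r - r\<^sup>2) < H x0"
    using gaussian_decay[OF H0, of C "d + d" "2 * norm a"] by blast
  have small: "H x < H x0" if "norm x > R" for x
  proof -
    have "H x \<le> (C * (1 + norm x) ^ (d + d)) * exp (2 * norm a * norm x - (norm x)\<^sup>2)"
      unfolding H_def
    proof (rule mult_mono)
      show "exp (2 * (a \<bullet> x) - x \<bullet> x) \<le> exp (2 * norm a * norm x - (norm x)\<^sup>2)"
        using norm_cauchy_schwarz[of a x] by (simp add: power2_norm_eq_inner)
      show "F x * F x \<le> C * (1 + norm x) ^ (d + d)" "0 \<le> C * (1 + norm x) ^ (d + d)"
        using C[of x] abs_ge_zero[of "F x * F x"] by linarith+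
    qed auto
    with R(2)[OF that] show ?thesis by linarith
  qed
  have dF: "continuous_on S F" for S
    by (rule polyfn_continuous_on[OF assms(1)])
  have "compact (K \<inter> cball 0 R)" using assms(3) by (simp add: closed_Int_compact)
  moreover have "x0 \<in> K \<inter> cball 0 R" using small[of x0] assms(4) by (force simp: not_less)
  moreover have "continuous_on (K \<inter> cball 0 R) H"
    unfolding H_def by (intro continuous_intros dF)
  ultimately obtain z where z: "z \<in> K \<inter> cball 0 R" "\<And>x. x \<in> K \<inter> cball 0 R \<Longrightarrow> H x \<le> H z"
    using continuous_attains_sup[of "K \<inter> cball 0 R" H] by blast
  then have z0: "H x0 \<le> H z" using \<open>x0 \<in> K \<inter> cball 0 R\<close> by blast
  have max: "H x \<le> H z" if "x \<in> K" for x
  proof (cases "norm x > R")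
    case True
    with small[of x] z0 show ?thesis by linarith
  next
    case False
    with z that show ?thesis by auto
  qed
  have Fz: "F z \<noteq> 0" using z0 H0 by (auto simp: H_def)
  then have zin: "z \<in> interior K" using inner z by blast
  have "F' i z + F z * (a $ i - z $ i) = 0" for i
  proof -
    define H' where "H' h = (F z * F z) * (exp (2 * (a \<bullet> z) - z \<bullet> z) * (2 * (a \<bullet> h) - (z \<bullet> h + h \<bullet> z))) 
      + (F z * (\<Sum>i\<in>UNIV. h $ i * F' i z) + (\<Sum>i\<in>UNIV. h $ i * F' i z) * F z) * exp (2 * (a \<bullet> z) - z \<bullet> z)" for h
    have "((\<lambda>x. exp (2 * (a \<bullet> x) - x \<bullet> x)) has_derivative
        (\<lambda>h. exp (2 * (a \<bullet> z) - z \<bullet> z) * (2 * (a \<bullet> h) - (z \<bullet> h + h \<bullet> z)))) (at z)"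
      by (auto intro!: derivative_eq_intros simp: fun_eq_iff algebra_simps)
    then have "(H has_derivative H') (at z)"
      unfolding H_def H'_def by (intro has_derivative_mult F')
    then have "H' = (\<lambda>v. 0)"
      using differential_zero_maxmin[of z "interior K" H H'] zin max interior_subset by blast
    then have "H' (axis i 1) = 0" by simp
    moreover have "(\<Sum>j\<in>UNIV. (axis i 1 :: real^'p) $ j * F' j z) = F' i z"
      by (subst sum.remove[of _ i]) (auto simp: axis_def)
    ultimately have "2 * exp (2 * (a \<bullet> z) - z \<bullet> z) * F z * (F' i z + F z * (a $ i - z $ i)) = 0"
      by (simp add: H'_def inner_axis inner_commute[of "axis i 1"] algebra_simps)
    with Fz show ?thesis by simp
  qed
  then have "z $ i * F z - F' i z = a $ i * F z" for i
    by (smt (verit) mult.commute right_diff_distrib)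
  with Fz z show ?thesis by blast
qed

text \<open>A fixed numbering of the finite index type by \<open>0, \<dots>, p - 1\<close>.\<close>

definition idx :: "'p::finite \<Rightarrow> nat" where
  "idx = (SOME f. bij_betw f UNIV {..<CARD('p)})"

lemma bij_idx: "bij_betw (idx :: 'p::finite \<Rightarrow> nat) UNIV {..<CARD('p)}"
proof -
  have "\<exists>f. bij_betw f (UNIV :: 'p set) {..<CARD('p)}"
    using ex_bij_betw_finite_nat[of "UNIV :: 'p set"] by (simp add: lessThan_atLeast0)
  then show ?thesis unfolding idx_def by (rule someI_ex)
qed

text \<open>
  The linear form \<open>x \<mapsto> \<Sum>\<^sub>i x\<^sub>i q\<^sup>i\<close>. For two different points, the difference of its values is a
  nonzero polynomial in \<open>q\<close> of degree less than \<open>p\<close>, so that only few \<open>q\<close> fail to separate the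
  points.
\<close>

definition moment_form :: "nat \<Rightarrow> real^'p::finite \<Rightarrow> real" where
  "moment_form q x = (\<Sum>i\<in>UNIV. x $ i * real q ^ idx i)"

lemma moment_form_collisions:
  fixes x y :: "real^'p::finite"
  assumes "x \<noteq> y"
  shows "finite {q. moment_form q x = moment_form q y} \<and>
         card {q. moment_form q x = moment_form q y} \<le> CARD('p)"
proof -
  define c where "c j = (x - y) $ (inv_into UNIV (idx :: 'p \<Rightarrow> nat) j)" for j
  have inv: "inv_into UNIV idx (idx i) = i" for i :: 'p
    using bij_idx by (intro inv_f_f) (auto simp: bij_betw_def)
  obtain i where i: "x $ i \<noteq> y $ i" using assms by (auto simp: vec_eq_iff)
  have ile: "idx i \<le> CARD('p)" using bij_betwE[OF bij_idx[where 'p='p]] by (simp add: less_imp_le)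
  have "c (idx i) \<noteq> 0" using i by (simp add: c_def inv)
  define c' where "c' j = (if j < CARD('p) then c j else 0)" for j
  have "c' (idx i) \<noteq> 0" using \<open>c (idx i) \<noteq> 0\<close> bij_betwE[OF bij_idx[where 'p='p]] by (auto simp: c'_def)
  then have "\<exists>j\<le>CARD('p). c' j \<noteq> 0" using ile by blast
  note rb = polyfun_rootbound[OF this]
  have eq: "(\<Sum>j\<le>CARD('p). c' j * t ^ j) = (\<Sum>i\<in>UNIV. (x - y) $ i * t ^ idx i)" for t :: real
  proof -
    have "(\<Sum>j\<le>CARD('p). c' j * t ^ j) = (\<Sum>j<CARD('p). c j * t ^ j)"
      by (simp add: lessThan_Suc_atMost[symmetric] c'_def)
    also have "\<dots> = (\<Sum>i\<in>(UNIV :: 'p set). c (idx i) * t ^ idx i)"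
      by (rule sum.reindex_bij_betw[OF bij_idx[where 'p='p], symmetric])
    finally show ?thesis by (simp add: c_def inv)
  qed
  define Z where "Z = {t :: real. (\<Sum>j\<le>CARD('p). c' j * t ^ j) = 0}"
  have sub: "real ` {q. moment_form q x = moment_form q y} \<subseteq> Z"
    by (auto simp: Z_def eq moment_form_def left_diff_distrib sum_subtractf)
  have inj: "inj_on real A" for A by (simp add: inj_on_def)
  have fin: "finite Z" "card Z \<le> CARD('p)" using rb by (auto simp: Z_def)
  have "finite (real ` {q. moment_form q x = moment_form q y})"
    using sub fin finite_subset by blast
  then have "finite {q. moment_form q x = moment_form q y}" using finite_image_iff[OF inj] by blast
  moreover have "card {q. moment_form q x = moment_form q y} \<le> card Z"
    using card_inj_on_le[OF inj sub fin(1)] .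
  ultimately show ?thesis using fin by simp
qed

text \<open>The bound for \<open>q\<close> depends on the number of points only, not on the points.\<close>

lemma separating_moment_form:
  fixes Z :: "(real^'p::finite) set"
  assumes "finite Z"
  shows "\<exists>q\<le>card Z * card Z * CARD('p). inj_on (moment_form q) Z"
proof -
  define T where "T = {w \<in> Z \<times> Z. fst w \<noteq> snd w}"
  define bad where "bad w = {q. moment_form q (fst w) = moment_form q (snd w)}"
      for w :: "(real^'p) \<times> (real^'p)"
  have fT: "finite T" "card T \<le> card Z * card Z"
    using card_mono[of "Z \<times> Z" T] assms by (auto simp: T_def card_cartesian_product)
  have fb: "finite (\<Union>w\<in>T. bad w)" using fT moment_form_collisions by (auto simp: T_def bad_def)
  have "card (\<Union>w\<in>T. bad w) \<le> (\<Sum>w\<in>T. card (bad w))" by (rule card_UN_le[OF fT(1)])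
  also have "\<dots> \<le> (\<Sum>w\<in>T. CARD('p))"
    using moment_form_collisions by (intro sum_mono) (auto simp: T_def bad_def)
  also have "\<dots> \<le> card Z * card Z * CARD('p)" using fT by simp
  finally have "card (\<Union>w\<in>T. bad w) < card {..card Z * card Z * CARD('p)}" by simp
  then have "\<not> {..card Z * card Z * CARD('p)} \<subseteq> (\<Union>w\<in>T. bad w)"
    using card_mono[OF fb] by (meson not_less)
  then obtain q where q: "q \<le> card Z * card Z * CARD('p)" "q \<notin> (\<Union>w\<in>T. bad w)" by auto
  then have "inj_on (moment_form q) Z" by (auto simp: inj_on_def T_def bad_def)
  with q show ?thesis by blast
qed

text \<open>
  Finitely many nonzero polynomials have a common point of nonvanishing. Kronecker's substitution
  \<open>y\<^sub>i = t\<^sup>w\<^sup>(\<^sup>i\<^sup>)\<close>, with weights \<open>w(i)\<close> that separate the exponent vectors, reduces this to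
  polynomials in \<open>t\<close>.
\<close>

lemma common_nonzero:
  fixes c :: "'q \<Rightarrow> ('p::finite \<Rightarrow> nat) \<Rightarrow> real"
  assumes "finite Q" "\<And>q. q \<in> Q \<Longrightarrow> \<exists>a\<in>expvecs S. c q a \<noteq> 0"
  shows "\<exists>y. \<forall>q\<in>Q. (\<Sum>a\<in>expvecs S. c q a * monomial a y) \<noteq> 0"
proof -
  define v where "v a = (\<chi> i. real (a i))" for a :: "'p \<Rightarrow> nat"
  have injv: "inj v" by (auto simp: inj_def v_def vec_eq_iff)
  obtain r where r: "inj_on (moment_form r) (v ` expvecs S)"
    using separating_moment_form[of "v ` expvecs S"] by auto
  define \<kappa> where "\<kappa> a = (\<Sum>i\<in>UNIV. a i * r ^ idx i)" for a :: "'p \<Rightarrow> nat"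
  have "moment_form r (v a) = real (\<kappa> a)" for a by (simp add: moment_form_def v_def \<kappa>_def)
  then have inj: "\<kappa> a = \<kappa> b \<longleftrightarrow> a = b" if "a \<in> expvecs S" "b \<in> expvecs S" for a b
    using inj_onD[OF r, of "v a" "v b"] injD[OF injv, of a b] that by auto
  define y :: "real \<Rightarrow> real^'p" where "y t = (\<chi> i. t ^ (r ^ idx i))" for t
  have mon: "monomial a (y t) = t ^ \<kappa> a" for a t
    by (simp add: monomial_def y_def \<kappa>_def power_sum power_mult[symmetric] mult.commute)
  define P where "P q = (\<Sum>a\<in>expvecs S. Polynomial.monom (c q a) (\<kappa> a))" for q
  have Pv: "poly (P q) t = (\<Sum>a\<in>expvecs S. c q a * monomial a (y t))" for q t
    by (simp add: P_def poly_sum poly_monom mon)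
  have "P q \<noteq> 0" if q: "q \<in> Q" for q
  proof -
    obtain b where b: "b \<in> expvecs S" "c q b \<noteq> 0" using assms(2)[OF q] by blast
    have "coeff (P q) (\<kappa> b) = (\<Sum>a\<in>expvecs S. if a = b then c q a else 0)"
      unfolding P_def coeff_sum by (intro sum.cong) (auto simp: inj b)
    then have "coeff (P q) (\<kappa> b) = c q b" using b by simp
    with b show ?thesis by auto
  qed
  then have "finite (\<Union>q\<in>Q. {t. poly (P q) t = 0})"
    using assms(1) by (intro finite_UN_I poly_roots_finite) auto
  then obtain t where "t \<notin> (\<Union>q\<in>Q. {t. poly (P q) t = 0})"
    using ex_new_if_finite infinite_UNIV_char_0 by blast
  then show ?thesis by (intro exI[of _ "y t"]) (auto simp: Pv)
qed

text \<open>
  The rational functions \<open>N\<^sub>i/F\<close> and the linear form \<open>L\<close> satisfy a nontrivial polynomial relation of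
  degree at most \<open>m = (e + 1)\<^sup>p\<close> in \<open>L\<close>; it is stated with the denominators cleared by \<open>F\<^sup>m\<close>. The
  products in question have degree at most \<open>em + m\<close>, and they outnumber the monomials of that
  degree.
\<close>

lemma algebraic_relation:
  fixes F L :: "real^'p::finite \<Rightarrow> real" and N :: "'p \<Rightarrow> real^'p \<Rightarrow> real"
  assumes F: "polyfn e F" and N: "\<And>i. polyfn e (N i)" and L: "polyfn 1 L"
  defines "m \<equiv> (e + 1) ^ CARD('p)"
  shows "\<exists>c. (\<exists>b\<le>m. \<exists>a\<in>expvecs m. c a b \<noteq> 0) \<and>
           (\<forall>x. (\<Sum>a\<in>expvecs m. \<Sum>b\<le>m. c a b * ((\<Prod>i\<in>UNIV. N i x ^ a i) * F x ^ (m - (\<Sum>i\<in>UNIV. a i))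
               * L x ^ b)) = 0)"
proof -
  define I where "I = (expvecs m :: ('p \<Rightarrow> nat) set) \<times> {..m}"
  define g where "g w x = (\<Prod>i\<in>UNIV. N i x ^ fst w i) * F x ^ (m - (\<Sum>i\<in>UNIV. fst w i))
      * L x ^ snd w" for w :: "('p \<Rightarrow> nat) \<times> nat" and x
  have "polyfn (e * m + m) (g w)" if "w \<in> I" for w
  proof -
    define s where "s = (\<Sum>i\<in>UNIV. fst w i)"
    have s: "s \<le> m" "snd w \<le> m" using that by (auto simp: I_def expvecs_def s_def)
    have "polyfn (\<Sum>i\<in>UNIV. fst w i * e) (\<lambda>x. \<Prod>i\<in>UNIV. N i x ^ fst w i)"
      by (intro polyfn_prod polyfn_power N)
    then have 1: "polyfn (s * e) (\<lambda>x. \<Prod>i\<in>UNIV. N i x ^ fst w i)"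
      by (simp add: s_def sum_distrib_right)
    have 2: "polyfn ((m - s) * e) (\<lambda>x. F x ^ (m - s))" by (intro polyfn_power F)
    have 3: "polyfn (snd w * 1) (\<lambda>x. L x ^ snd w)" by (intro polyfn_power L)
    have e: "s * e + (m - s) * e \<le> e * m" using s
        by (metis add_mult_distrib le_add_diff_inverse mult.commute order_refl)
    show ?thesis unfolding g_def s_def[symmetric]
      by (rule polyfn_mult[OF polyfn_mult[OF 1 2 e] 3]) (use s in auto)
  qed
  moreover have "card (expvecs (e * m + m) :: ('p \<Rightarrow> nat) set) < card I"
  proof -
    have "card (expvecs (e * m + m) :: ('p \<Rightarrow> nat) set) \<le> (e + 1) ^ CARD('p) * card (expvecs m ::
        ('p \<Rightarrow> nat) set)"
      by (rule card_expvecs_le) (auto simp: algebra_simps)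
    also have "\<dots> < Suc m * card (expvecs m :: ('p \<Rightarrow> nat) set)"
      using zero_in_expvecs by (auto simp: m_def card_gt_0_iff)
    finally show ?thesis by (simp add: I_def card_cartesian_product mult.commute)
  qed
  moreover have "finite I" by (simp add: I_def)
  ultimately obtain c where c: "\<exists>w\<in>I. c w \<noteq> 0" "\<And>x. (\<Sum>w\<in>I. c w * g w x) = 0"
    using polyfn_dependent[of I "e * m + m" g] by auto
  have "(\<Sum>a\<in>expvecs m. \<Sum>b\<le>m. c (a, b) * g (a, b) x) = 0" for x
    using c(2)[of x] by (simp add: I_def sum.cartesian_product)
  moreover have "\<exists>b\<le>m. \<exists>a\<in>expvecs m. c (a, b) \<noteq> 0" using c(1) by (auto simp: I_def)
  ultimately show ?thesis by (intro exI[of _ "\<lambda>a b. c (a, b)"]) (auto simp: g_def)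
qed

theorem sign_pattern_bound:
  fixes f :: "'u \<Rightarrow> real^'p::finite \<Rightarrow> real"
  assumes D: "finite D" and f: "\<And>u. u \<in> D \<Longrightarrow> polyfn d (f u)"
    and pat: "\<And>\<sigma>. \<sigma> \<subseteq> D \<Longrightarrow> \<exists>x. \<forall>u\<in>D. (u \<in> \<sigma> \<longrightarrow> 0 < f u x) \<and> (u \<notin> \<sigma> \<longrightarrow> f u x < 0)"
  shows "2 ^ card D \<le> (card D * d + 2) ^ CARD('p)"
proof -
  define F where "F x = (\<Prod>u\<in>D. f u x)" for x
  have "polyfn (\<Sum>u\<in>D. d) F" unfolding F_def by (intro polyfn_prod f)
  then have pF: "polyfn (card D * d) F" by simp
  then obtain F' where F': "\<And>i. polyfn (card D * d) (F' i)"
      "\<And>x. (F has_derivative (\<lambda>h. \<Sum>i\<in>UNIV. h $ i * F' i x)) (at x)"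
    using polyfn_has_derivative by blast
  define K where "K \<sigma> = {x. \<forall>u\<in>D. (u \<in> \<sigma> \<longrightarrow> 0 \<le> f u x) \<and> (u \<notin> \<sigma> \<longrightarrow> f u x \<le> 0)}" for \<sigma>
  have cf: "continuous_on UNIV (f u)" if "u \<in> D" for u
    by (rule polyfn_continuous_on[OF f[OF that]])
  have z: "\<exists>z\<in>K \<sigma>. F z \<noteq> 0 \<and> (\<forall>i. z $ i * F z - F' i z = a $ i * F z)" if \<sigma>: "\<sigma> \<subseteq> D" for \<sigma> a
  proof -
    obtain x0 where x0: "\<And>u. u \<in> D \<Longrightarrow> (u \<in> \<sigma> \<longrightarrow> 0 < f u x0) \<and> (u \<notin> \<sigma> \<longrightarrow> f u x0 < 0)"
      using pat[OF \<sigma>] by blast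
    show ?thesis
    proof (rule cell_critical_point[OF pF F'(2)])
      have "K \<sigma> = (\<Inter>u\<in>D. {x. (u \<in> \<sigma> \<longrightarrow> 0 \<le> f u x) \<and> (u \<notin> \<sigma> \<longrightarrow> f u x \<le> 0)})"
        by (auto simp: K_def)
      moreover have "closed {x. (u \<in> \<sigma> \<longrightarrow> 0 \<le> f u x) \<and> (u \<notin> \<sigma> \<longrightarrow> f u x \<le> 0)}" if "u \<in> D" for u
        using cf[OF that] by (cases "u \<in> \<sigma>") (auto intro!: closed_Collect_le continuous_intros)
      ultimately show "closed (K \<sigma>)" by auto
      show "x0 \<in> K \<sigma>" using x0 by (force simp: K_def)
      show "F x0 \<noteq> 0" using x0 D by (force simp: F_def)
    next
      fix x assume x: "x \<in> K \<sigma>" "F x \<noteq> 0"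
      define U where "U = (\<Inter>u\<in>D. {x. (u \<in> \<sigma> \<longrightarrow> 0 < f u x) \<and> (u \<notin> \<sigma> \<longrightarrow> f u x < 0)})"
      have "open {x. (u \<in> \<sigma> \<longrightarrow> 0 < f u x) \<and> (u \<notin> \<sigma> \<longrightarrow> f u x < 0)}" if "u \<in> D" for u
        using cf[OF that] by (cases "u \<in> \<sigma>") (auto intro!: open_Collect_less continuous_intros)
      then have "open U" unfolding U_def using D by (intro open_INT) auto
      moreover have "x \<in> U" using x D by (force simp: U_def K_def F_def less_le)
      moreover have "U \<subseteq> K \<sigma>" by (force simp: U_def K_def)
      ultimately show "x \<in> interior (K \<sigma>)" by (rule interiorI)
    qed
  qed
  define e where "e = card D * d + 1"
  define m where "m = (e + 1) ^ CARD('p)"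
  define M where "M = (2::nat) ^ card D"
  define N where "N i x = x $ i * F x - F' i x" for i x
  have pN: "polyfn e (N i)" for i
  proof -
    have "polyfn e (\<lambda>x. x $ i * F x)"
      by (rule polyfn_mult[OF polyfn_var[of 1] pF]) (auto simp: e_def)
    moreover have "polyfn e (F' i)" using F'(1) by (rule polyfn_mono) (simp add: e_def)
    ultimately show ?thesis unfolding N_def by (rule polyfn_diff)
  qed
  have pFe: "polyfn e F" using pF by (rule polyfn_mono) (simp add: e_def)
  have pL: "polyfn 1 (moment_form q :: real^'p \<Rightarrow> real)" for q
    unfolding moment_form_def
    by (intro polyfn_sum polyfn_mult[OF polyfn_var[of 1] polyfn_const[of 0]]) auto
  \<comment> \<open>\<open>Q\<close> contains a \<open>q\<close> that separates any given \<open>M\<close> points; the relations must be fixed for all of \<open>Q\<close>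
     before the points, which depend on \<open>y\<close>, are known\<close>
  define Q where "Q = {..M * M * CARD('p)}"
  have "\<forall>q. \<exists>c. (\<exists>b\<le>m. \<exists>a\<in>expvecs m. c a b \<noteq> 0) \<and>
           (\<forall>x. (\<Sum>a\<in>expvecs m. \<Sum>b\<le>m. c a b * ((\<Prod>i\<in>UNIV. N i x ^ a i) * F x ^ (m - (\<Sum>i\<in>UNIV. a i))
               * moment_form q x ^ b)) = 0)"
    using algebraic_relation[OF pFe pN pL, folded m_def] by (rule allI)
  then obtain c where c: "\<forall>q. (\<exists>b\<le>m. \<exists>a\<in>expvecs m. c q a b \<noteq> 0) \<and>
           (\<forall>x. (\<Sum>a\<in>expvecs m. \<Sum>b\<le>m. c q a b * ((\<Prod>i\<in>UNIV. N i x ^ a i) * F x ^ (m - (\<Sum>i\<in>UNIV. a i))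
               * moment_form q x ^ b)) = 0)"
    by (rule choice[THEN exE])
  then have "\<forall>q. \<exists>b. b \<le> m \<and> (\<exists>a\<in>expvecs m. c q a b \<noteq> 0)" by auto
  then obtain \<beta> where \<beta>: "\<And>q. \<beta> q \<le> m" "\<And>q. \<exists>a\<in>expvecs m. c q a (\<beta> q) \<noteq> 0"
    by (elim choice[THEN exE]) auto
  obtain y where y: "\<And>q. q \<in> Q \<Longrightarrow> (\<Sum>a\<in>expvecs m. c q a (\<beta> q) * monomial a y) \<noteq> 0"
    using common_nonzero[of Q m "\<lambda>q a. c q a (\<beta> q)"] \<beta>(2) by (auto simp: Q_def)
  from z[of _ y] obtain \<zeta> where \<zeta>: "\<And>\<sigma>. \<sigma> \<subseteq> D \<Longrightarrow> \<zeta> \<sigma> \<in> K \<sigma>" "\<And>\<sigma>. \<sigma> \<subseteq> D \<Longrightarrow> F (\<zeta> \<sigma>) \<noteq> 0"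
      "\<And>\<sigma> i. \<sigma> \<subseteq> D \<Longrightarrow> N i (\<zeta> \<sigma>) = y $ i * F (\<zeta> \<sigma>)"
    unfolding N_def by metis
  have "inj_on \<zeta> (Pow D)"
  proof (rule inj_onI)
    have sub: "\<sigma> \<subseteq> \<tau>" if "\<sigma> \<in> Pow D" "\<tau> \<in> Pow D" "\<zeta> \<sigma> = \<zeta> \<tau>" for \<sigma> \<tau>
    proof
      fix u assume u: "u \<in> \<sigma>"
      then have "u \<in> D" using that by auto
      then have "f u (\<zeta> \<sigma>) \<noteq> 0" using \<zeta>(2)[of \<sigma>] that(1) D by (auto simp: F_def)
      then show "u \<in> \<tau>" using \<zeta>(1)[of \<sigma>] \<zeta>(1)[of \<tau>] that u \<open>u \<in> D\<close> by (force simp: K_def)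
    qed
    fix \<sigma> \<tau> assume "\<sigma> \<in> Pow D" "\<tau> \<in> Pow D" "\<zeta> \<sigma> = \<zeta> \<tau>"
    then show "\<sigma> = \<tau>" using sub[of \<sigma> \<tau>] sub[of \<tau> \<sigma>] by simp
  qed
  then have cardZ: "card (\<zeta> ` Pow D) = M" by (simp add: card_image card_Pow D M_def)
  obtain q where q: "q \<in> Q" "inj_on (moment_form q) (\<zeta> ` Pow D)"
    using separating_moment_form[of "\<zeta> ` Pow D"] D by (auto simp: cardZ Q_def)
  \<comment> \<open>coefficients of the univariate polynomial that remains after \<open>N\<^sub>i/F = y\<^sub>i\<close> has been substituted\<close>
  define C where "C b = (\<Sum>a\<in>expvecs m. c q a b * monomial a y)" for b
  have "C (\<beta> q) \<noteq> 0" using y[OF q(1)] by (simp add: C_def)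
  then have "\<exists>b\<le>m. C b \<noteq> 0" using \<beta>(1) by blast
  note rb = polyfun_rootbound[OF this]
  have "moment_form q ` \<zeta> ` Pow D \<subseteq> {t. (\<Sum>b\<le>m. C b * t ^ b) = 0}"
  proof clarify
    fix \<sigma> assume \<sigma>: "\<sigma> \<subseteq> D"
    define x where "x = \<zeta> \<sigma>"
    have key: "c q a b * ((\<Prod>i\<in>UNIV. N i x ^ a i) * F x ^ (m - (\<Sum>i\<in>UNIV. a i)) * moment_form q x ^ b)
        = F x ^ m * (c q a b * monomial a y * moment_form q x ^ b)" if "a \<in> expvecs m" for a b
    proof -
      have "(\<Prod>i\<in>UNIV. N i x ^ a i) = monomial a y * F x ^ (\<Sum>i\<in>UNIV. a i)"
        using \<zeta>(3)[OF \<sigma>] by (simp add: x_def monomial_def power_mult_distrib prod.distrib power_sum)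
      moreover have "F x ^ (\<Sum>i\<in>UNIV. a i) * F x ^ (m - (\<Sum>i\<in>UNIV. a i)) = F x ^ m"
        using that by (simp add: power_add[symmetric] expvecs_def)
      ultimately show ?thesis by (simp add: algebra_simps)
    qed
    have "(\<Sum>a\<in>expvecs m. \<Sum>b\<le>m. F x ^ m * (c q a b * monomial a y * moment_form q x ^ b))
        = (\<Sum>a\<in>expvecs m. \<Sum>b\<le>m. c q a b * ((\<Prod>i\<in>UNIV. N i x ^ a i) * F x ^ (m - (\<Sum>i\<in>UNIV. a i))
            * moment_form q x ^ b))"
      by (intro sum.cong refl key[symmetric])
    also have "\<dots> = 0" using c[rule_format, of q, THEN conjunct2, rule_format, of x] .
    finally have "F x ^ m * (\<Sum>a\<in>expvecs m. \<Sum>b\<le>m. c q a b * monomial a y * moment_form q x ^ b) = 0"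
      by (simp only: sum_distrib_left)
    then have "(\<Sum>a\<in>expvecs m. \<Sum>b\<le>m. c q a b * monomial a y * moment_form q x ^ b) = 0"
      using \<zeta>(2)[OF \<sigma>] by (simp add: x_def)
    then show "(\<Sum>b\<le>m. C b * moment_form q (\<zeta> \<sigma>) ^ b) = 0"
      unfolding C_def x_def[symmetric] sum_distrib_right by (subst sum.swap)
  qed
  then have "card (moment_form q ` \<zeta> ` Pow D) \<le> m"
    using rb by (meson card_mono le_trans)
  then have "M \<le> m" using q(2) cardZ by (simp add: card_image)
  then show ?thesis by (simp add: M_def m_def e_def)
qed

section \<open>Fundamental solutions and the final output\<close>

lemma has_vector_derivative_componentI:
  fixes f :: "real \<Rightarrow> ('a::real_normed_vector)^'n::finite"
  assumes "\<And>i. ((\<lambda>t. f t $ i) has_vector_derivative f' $ i) (at x within S)"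
  shows "(f has_vector_derivative f') (at x within S)"
  unfolding has_vector_derivative_def has_derivative_def
proof (intro conjI vec_tendstoI)
  fix i
  show "((\<lambda>y. ((f y - f (Lim (at x within S) (\<lambda>x. x)) - (y - Lim (at x within S) (\<lambda>x. x)) *\<^sub>R f')
      /\<^sub>R norm (y - Lim (at x within S) (\<lambda>x. x))) $ i) \<longlongrightarrow> 0 $ i) (at x within S)"
    using assms[of i] unfolding has_vector_derivative_def has_derivative_def by simp
qed (rule bounded_linear_scaleR_left)

lemma matrix_add_rdistrib: "((A :: real^'n::finite^'m) + B) ** C = A ** C + B ** C"
  by (simp add: matrix_matrix_mult_def vec_eq_iff sum.distrib distrib_right)

lemma bounded_bilinear_matrix_mult:
  "bounded_bilinear ((**) :: real^'n::finite^'m::finite \<Rightarrow> real^'k::finite^'n \<Rightarrow> real^'k^'m)"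
  unfolding bilinear_conv_bounded_bilinear[symmetric] bilinear_def
  by (auto intro!: linearI simp: matrix_add_ldistrib matrix_add_rdistrib matrix_scalar_ac scalar_matrix_assoc)

lemma bounded_bilinear_matrix_vector_mult:
  "bounded_bilinear ((*v) :: real^'n::finite^'m::finite \<Rightarrow> real^'n \<Rightarrow> real^'m)"
  unfolding bilinear_conv_bounded_bilinear[symmetric] bilinear_def
  by (auto intro!: linearI simp: matrix_vector_right_distrib matrix_vector_mult_add_rdistrib
      matrix_vector_mult_scaleR scaleR_matrix_vector_assoc)

lemmas matrix_mult_has_vector_derivative [derivative_intros] =
  bounded_bilinear.has_vector_derivative[OF bounded_bilinear_matrix_mult]
lemmas matrix_vector_mult_has_vector_derivative [derivative_intros] =
  bounded_bilinear.has_vector_derivative[OF bounded_bilinear_matrix_vector_mult]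
lemmas matrix_vector_mult_continuous_on [continuous_intros] =
  bounded_bilinear.continuous_on[OF bounded_bilinear_matrix_vector_mult]

text \<open>
  \<open>fundamental A \<Phi>\<close>: \<open>\<Phi> t\<close> is the matrix exponential of \<open>tA\<close>, characterised by its initial value
  problem and the fact that it commutes with \<open>A\<close>.
\<close>

definition fundamental :: "real^'n::finite^'n \<Rightarrow> (real \<Rightarrow> real^'n^'n) \<Rightarrow> bool" where
  "fundamental A \<Phi> \<longleftrightarrow> \<Phi> 0 = mat 1 \<and>
     (\<forall>t. (\<Phi> has_vector_derivative A ** \<Phi> t) (at t)) \<and> (\<forall>t. A ** \<Phi> t = \<Phi> t ** A)"

text \<open>The exponential series, differentiated termwise in each entry.\<close>

lemma fundamental_exists:
  fixes A :: "real^'n::finite^'n"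
  shows "\<exists>\<Phi>. fundamental A \<Phi>"
proof -
  define P where "P k = (((**) A) ^^ k) (mat 1)" for k
  have P0: "P 0 = mat 1" and PS: "P (Suc k) = A ** P k" for k by (simp_all add: P_def)
  have comm: "A ** P k = P k ** A" for k
  proof (induction k)
    case (Suc k)
    have "A ** P (Suc k) = A ** (P k ** A)" by (simp only: PS Suc)
    then show ?case by (simp only: PS matrix_mul_assoc)
  qed (simp add: P0)
  obtain K where K': "0 < K \<and> (\<forall>(a :: real^'n^'n) (b :: real^'n^'n). norm (a ** b) \<le> norm a * norm b * K)"
    using bounded_bilinear.pos_bounded[OF bounded_bilinear_matrix_mult[where 'n='n and 'm='n and 'k='n]] ..
  then have K: "0 < K" "norm (a ** b) \<le> norm a * norm b * K" for a b :: "real^'n^'n"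
    by simp_all
  have bound: "norm (P k) \<le> norm (mat 1 :: real^'n^'n) * (norm A * K) ^ k" for k
  proof (induction k)
    case 0
    show ?case by (simp add: P0)
  next
    case (Suc k)
    have "norm (P (Suc k)) \<le> (norm A * K) * norm (P k)" using K(2)[of A "P k"] by (simp add: PS mult_ac)
    also have "\<dots> \<le> (norm A * K) * (norm (mat 1 :: real^'n^'n) * (norm A * K) ^ k)"
      using Suc K(1) by (intro mult_left_mono) auto
    finally show ?case by (simp add: mult_ac)
  qed
  define c where "c i j k = P k $ i $ j / fact k" for i j k
  have sm: "summable (\<lambda>k. c i j k * y ^ k)" for i j y
  proof (rule summable_comparison_test')
    show "summable (\<lambda>k. norm (mat 1 :: real^'n^'n) * (inverse (fact k) * (norm A * K * \<bar>y\<bar>) ^ k))"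
      by (intro summable_mult summable_exp)
    fix k :: nat
    have "\<bar>P k $ i $ j\<bar> \<le> norm (P k)"
      using order_trans[OF component_le_norm_cart Finite_Cartesian_Product.norm_nth_le] by blast
    then have "\<bar>P k $ i $ j\<bar> * \<bar>y\<bar> ^ k \<le> norm (mat 1 :: real^'n^'n) * (norm A * K) ^ k * \<bar>y\<bar> ^ k"
      using bound[of k] by (intro mult_right_mono) auto
    then show "norm (c i j k * y ^ k) \<le> norm (mat 1 :: real^'n^'n) * (inverse (fact k) * (norm A
        * K * \<bar>y\<bar>) ^ k)"
      by (simp add: c_def abs_mult power_abs power_mult_distrib field_simps)
  qed
  define \<Phi> where "\<Phi> t = (\<chi> i j. \<Sum>k. c i j k * t ^ k)" for t
  have left: "(A ** \<Phi> t) $ i $ j = (\<Sum>k. (A ** P k) $ i $ j / fact k * t ^ k)" for t i j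
  proof -
    have "(\<Sum>k. (A ** P k) $ i $ j / fact k * t ^ k) = (\<Sum>k. \<Sum>l\<in>UNIV. A $ i $ l * (c l j k * t ^ k))"
      by (simp add: c_def matrix_matrix_mult_def sum_distrib_right sum_divide_distrib mult.assoc)
    also have "\<dots> = (\<Sum>l\<in>UNIV. \<Sum>k. A $ i $ l * (c l j k * t ^ k))"
      by (intro suminf_sum summable_mult sm)
    also have "\<dots> = (A ** \<Phi> t) $ i $ j"
      using sm by (simp add: \<Phi>_def matrix_matrix_mult_def suminf_mult)
    finally show ?thesis by simp
  qed
  have right: "(\<Phi> t ** A) $ i $ j = (\<Sum>k. (P k ** A) $ i $ j / fact k * t ^ k)" for t i j
  proof -
    have "(\<Sum>k. (P k ** A) $ i $ j / fact k * t ^ k) = (\<Sum>k. \<Sum>l\<in>UNIV. A $ l $ j * (c i l k * t ^ k))"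
      by (simp add: c_def matrix_matrix_mult_def sum_distrib_right sum_divide_distrib mult.assoc
          mult.left_commute[of "A $ _ $ _"])
    also have "\<dots> = (\<Sum>l\<in>UNIV. \<Sum>k. A $ l $ j * (c i l k * t ^ k))"
      by (intro suminf_sum summable_mult sm)
    also have "\<dots> = (\<Phi> t ** A) $ i $ j"
      using sm by (simp add: \<Phi>_def matrix_matrix_mult_def suminf_mult mult.commute)
    finally show ?thesis by simp
  qed
  have "(\<Phi> has_vector_derivative A ** \<Phi> t) (at t)" for t
  proof (intro has_vector_derivative_componentI)
    fix i j
    have "diffs (c i j) k = (A ** P k) $ i $ j / fact k" for k
      by (simp add: diffs_def c_def PS field_simps del: of_nat_Suc)
    then have "((\<lambda>t. \<Sum>k. c i j k * t ^ k) has_real_derivative (A ** \<Phi> t) $ i $ j) (at t)"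
      using termdiffs_strong_converges_everywhere[of "c i j" t, OF sm] by (simp add: left)
    then show "((\<lambda>t. \<Phi> t $ i $ j) has_vector_derivative (A ** \<Phi> t) $ i $ j) (at t)"
      by (simp add: \<Phi>_def has_real_derivative_iff_has_vector_derivative)
  qed
  moreover have "\<Phi> 0 = mat 1"
    unfolding \<Phi>_def powser_zero by (simp add: vec_eq_iff c_def P0)
  moreover have "A ** \<Phi> t = \<Phi> t ** A" for t
    by (simp add: vec_eq_iff left right comm)
  ultimately show ?thesis unfolding fundamental_def by blast
qed

lemma fundamental_deriv:
  assumes "fundamental A \<Phi>"
  shows "(\<Phi> has_vector_derivative A ** \<Phi> t) (at t within S)"
  using assms by (auto simp: fundamental_def intro: has_vector_derivative_at_within)

lemma fundamental_deriv_neg: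
  assumes "fundamental A \<Phi>"
  shows "((\<lambda>t. \<Phi> (- t)) has_vector_derivative - (A ** \<Phi> (- t))) (at t within S)"
proof -
  have "((\<lambda>t::real. - t) has_vector_derivative - 1) (at t within S)"
    by (auto intro!: derivative_eq_intros)
  from vector_diff_chain_within[OF this fundamental_deriv[OF assms]]
  show ?thesis by (simp add: o_def)
qed

lemma fundamental_continuous_on:
  assumes "fundamental A \<Phi>"
  shows "continuous_on S \<Phi>" "continuous_on S (\<lambda>t. \<Phi> (- t))"
  using fundamental_deriv[OF assms] fundamental_deriv_neg[OF assms]
  by (meson continuous_on_vector_derivative)+

lemma fundamental_inverse:
  assumes "fundamental A \<Phi>"
  shows "\<Phi> (- t) ** \<Phi> t = mat 1" "\<Phi> t ** \<Phi> (- t) = mat 1"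
proof -
  have "((\<lambda>t. \<Phi> (- t) ** \<Phi> t) has_vector_derivative 0) (at t within UNIV)" for t
  proof -
    have "((\<lambda>t. \<Phi> (- t) ** \<Phi> t) has_vector_derivative
        \<Phi> (- t) ** (A ** \<Phi> t) + - (A ** \<Phi> (- t)) ** \<Phi> t) (at t within UNIV)"
      by (intro matrix_mult_has_vector_derivative fundamental_deriv fundamental_deriv_neg assms)
    moreover have "\<Phi> (- t) ** (A ** \<Phi> t) = A ** \<Phi> (- t) ** \<Phi> t"
    proof -
      have "A ** \<Phi> (- t) = \<Phi> (- t) ** A" using assms by (simp add: fundamental_def)
      then show ?thesis by (simp only: matrix_mul_assoc)
    qed
    moreover have "- (A ** \<Phi> (- t)) ** \<Phi> t = - (A ** \<Phi> (- t) ** \<Phi> t)"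
      by (rule bounded_bilinear.minus_left[OF bounded_bilinear_matrix_mult])
    ultimately show ?thesis by simp
  qed
  then obtain M where "\<And>t. \<Phi> (- t) ** \<Phi> t = M"
    using has_vector_derivative_zero_constant[of UNIV "\<lambda>t. \<Phi> (- t) ** \<Phi> t"] by auto
  moreover from this[of 0] have "M = mat 1" using assms by (simp add: fundamental_def)
  ultimately have all: "\<Phi> (- t) ** \<Phi> t = mat 1" for t by simp
  show "\<Phi> (- t) ** \<Phi> t = mat 1" "\<Phi> t ** \<Phi> (- t) = mat 1" using all[of t] all[of "- t"] by simp_all
qed

lemma fundamental_shift:
  assumes "fundamental A \<Phi>"
  shows "fundamental (A + mat \<epsilon>) (\<lambda>t. exp (\<epsilon> * t) *\<^sub>R \<Phi> t)"
proof -
  have m: "mat \<epsilon> = \<epsilon> *\<^sub>R (mat 1 :: real^'a^'a)" by (simp add: mat_def vec_eq_iff)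
  have l: "(A + mat \<epsilon>) ** M = A ** M + \<epsilon> *\<^sub>R M" for M :: "real^'a^'a"
    by (simp add: matrix_add_rdistrib m scalar_matrix_assoc[symmetric])
  have r: "M ** (A + mat \<epsilon>) = M ** A + \<epsilon> *\<^sub>R M" for M :: "real^'a^'a"
    by (simp add: matrix_add_ldistrib m matrix_scalar_ac scalar_matrix_assoc[symmetric])
  have "((\<lambda>t. exp (\<epsilon> * t)) has_real_derivative \<epsilon> * exp (\<epsilon> * t)) (at t)" for t
    by (auto intro!: derivative_eq_intros)
  from has_vector_derivative_scaleR[OF this fundamental_deriv[OF assms]]
  have "((\<lambda>t. exp (\<epsilon> * t) *\<^sub>R \<Phi> t) has_vector_derivative
      exp (\<epsilon> * t) *\<^sub>R (A ** \<Phi> t) + (\<epsilon> * exp (\<epsilon> * t)) *\<^sub>R \<Phi> t) (at t)" for t .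
  moreover have "exp (\<epsilon> * t) *\<^sub>R (A ** \<Phi> t) + (\<epsilon> * exp (\<epsilon> * t)) *\<^sub>R \<Phi> t
      = (A + mat \<epsilon>) ** (exp (\<epsilon> * t) *\<^sub>R \<Phi> t)" for t
    by (simp only: matrix_scalar_ac scalar_matrix_assoc[symmetric] l)
       (simp add: scaleR_add_right mult.commute)
  ultimately have "((\<lambda>t. exp (\<epsilon> * t) *\<^sub>R \<Phi> t) has_vector_derivative
      (A + mat \<epsilon>) ** (exp (\<epsilon> * t) *\<^sub>R \<Phi> t)) (at t)" for t by simp
  moreover have "(A + mat \<epsilon>) ** (e *\<^sub>R \<Phi> t) = (e *\<^sub>R \<Phi> t) ** (A + mat \<epsilon>)" for e t
    using assms by (simp only: matrix_scalar_ac scalar_matrix_assoc[symmetric] l r) (simp add: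
        fundamental_def scaleR_add_right mult.commute)
  ultimately show ?thesis using assms by (simp add: fundamental_def)
qed

text \<open>Existence and uniqueness of the trajectory, with the variation of constants formula.\<close>

lemma final_output_eq:
  fixes A :: "real^'n::finite^'n" and B :: "real^'m::finite^'n"
  assumes \<Phi>: "fundamental A \<Phi>" and u: "continuous_on {0..1} u"
  shows "final_output A B C x0 u =
    (C *v (\<Phi> 1 *v (x0 + integral {0..1} (\<lambda>s. \<Phi> (- s) *v (B *v u s))))) $ 1"
proof -
  define J where "J t = integral {0..t} (\<lambda>s. \<Phi> (- s) *v (B *v u s))" for t
  have cont: "continuous_on {0..1} (\<lambda>s. \<Phi> (- s) *v (B *v u s))"
    by (intro continuous_intros fundamental_continuous_on[OF \<Phi>] u)
  have uniq: "x 1 = \<Phi> 1 *v (x0 + J 1)" if x: "is_trajectory A B x0 u x" for x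
  proof -
    have "((\<lambda>t. \<Phi> (- t) *v x t) has_vector_derivative \<Phi> (- t) *v (B *v u t)) (at t within {0..1})"
      if t: "t \<in> {0..1}" for t
    proof -
      have "((\<lambda>t. \<Phi> (- t) *v x t) has_vector_derivative
          \<Phi> (- t) *v (A *v x t + B *v u t) + - (A ** \<Phi> (- t)) *v x t) (at t within {0..1})"
        using x t unfolding is_trajectory_def
        by (intro matrix_vector_mult_has_vector_derivative fundamental_deriv_neg \<Phi>) auto
      moreover have "\<Phi> (- t) *v (A *v x t) = (A ** \<Phi> (- t)) *v x t"
        using \<Phi> by (simp add: fundamental_def matrix_vector_mul_assoc)
      moreover have "- (A ** \<Phi> (- t)) *v x t = - ((A ** \<Phi> (- t)) *v x t)"
        by (rule bounded_bilinear.minus_left[OF bounded_bilinear_matrix_vector_mult])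
      ultimately show ?thesis by (simp add: matrix_vector_right_distrib)
    qed
    then have "((\<lambda>s. \<Phi> (- s) *v (B *v u s)) has_integral (\<Phi> (- 1) *v x 1 - \<Phi> (- 0) *v x 0)) {0..1}"
      using fundamental_theorem_of_calculus[of 0 1 "\<lambda>t. \<Phi> (- t) *v x t"] by auto
    then have "J 1 = \<Phi> (- 1) *v x 1 - x0"
      using x \<Phi> by (simp add: J_def integral_unique is_trajectory_def fundamental_def)
    then have "\<Phi> 1 *v (x0 + J 1) = (\<Phi> 1 ** \<Phi> (- 1)) *v x 1"
      by (simp add: matrix_vector_mul_assoc)
    then show ?thesis using fundamental_inverse[OF \<Phi>, of 1] by simp
  qed
  have "is_trajectory A B x0 u (\<lambda>t. \<Phi> t *v (x0 + J t))"
    unfolding is_trajectory_def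
  proof (intro conjI ballI)
    show "\<Phi> 0 *v (x0 + J 0) = x0" using \<Phi> by (simp add: fundamental_def J_def)
    fix t :: real assume t: "t \<in> {0..1}"
    have "((\<lambda>t. x0 + J t) has_vector_derivative \<Phi> (- t) *v (B *v u t)) (at t within {0..1})"
      unfolding J_def using integral_has_vector_derivative[OF cont t]
      by (auto intro!: derivative_eq_intros)
    then have "((\<lambda>t. \<Phi> t *v (x0 + J t)) has_vector_derivative
        \<Phi> t *v (\<Phi> (- t) *v (B *v u t)) + (A ** \<Phi> t) *v (x0 + J t)) (at t within {0..1})"
      by (intro matrix_vector_mult_has_vector_derivative fundamental_deriv \<Phi>)
    moreover have "\<Phi> t *v (\<Phi> (- t) *v (B *v u t)) = B *v u t"
      using fundamental_inverse[OF \<Phi>, of t]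
          by (simp only: matrix_vector_mul_assoc matrix_mul_assoc matrix_mul_lid)
    ultimately show "((\<lambda>t. \<Phi> t *v (x0 + J t)) has_vector_derivative
        A *v (\<Phi> t *v (x0 + J t)) + B *v u t) (at t within {0..1})"
      by (simp add: matrix_vector_mul_assoc add.commute)
  qed
  then have ex: "\<exists>x. is_trajectory A B x0 u x \<and> (C *v (\<Phi> 1 *v (x0 + J 1))) $ 1 = (C *v x 1) $ 1"
    by (intro exI conjI) auto
  show ?thesis
    unfolding final_output_def J_def[symmetric]
  proof (rule the_equality, rule ex)
    fix y assume "\<exists>x. is_trajectory A B x0 u x \<and> y = (C *v x 1) $ 1"
    then show "y = (C *v (\<Phi> 1 *v (x0 + J 1))) $ 1" using uniq by metis
  qed
qed

text \<open>
  The contribution \<open>\<integral>\<^sub>0\<^sup>1 f(s) \<Phi>(1 - s) v ds\<close> to the state at time \<open>1\<close> of a scalar input \<open>f\<close> that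
  acts in direction \<open>v\<close>; the factor \<open>\<Phi>(1)\<close> is taken out of the integral.
\<close>

definition response :: "(real \<Rightarrow> real^'n::finite^'n) \<Rightarrow> (real \<Rightarrow> real) \<Rightarrow> real^'n \<Rightarrow> real^'n" where
  "response \<Phi> f v = \<Phi> 1 *v integral {0..1} (\<lambda>s. f s *\<^sub>R (\<Phi> (- s) *v v))"

lemma final_output_response:
  fixes A :: "real^'n::finite^'n" and B :: "real^'m::finite^'n" and G :: "real^'k::finite^'m"
  assumes \<Phi>: "fundamental A \<Phi>" and \<omega>: "\<And>j. continuous_on {0..1} (\<omega> j)"
  shows "final_output A B C x0 (\<lambda>t\<in>{0..1}. G *v (\<chi> j. \<omega> j t)) =
    (C *v (\<Phi> 1 *v x0)) $ 1 + (\<Sum>j\<in>UNIV. (C *v response \<Phi> (\<omega> j) (B *v column j G)) $ 1)"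
proof -
  define u where "u = (\<lambda>t\<in>{0..1}. G *v (\<chi> j. \<omega> j t))"
  have Gw: "G *v (\<chi> j. \<omega> j t) = (\<Sum>j\<in>UNIV. \<omega> j t *\<^sub>R column j G)" for t
    by (simp add: matrix_mult_sum scalar_mult_eq_scaleR)
  have ueq: "u t = (\<Sum>j\<in>UNIV. \<omega> j t *\<^sub>R column j G)" if "t \<in> {0..1}" for t
    using that by (simp only: u_def restrict_apply' Gw)
  have "continuous_on {0..1} (\<lambda>t. \<Sum>j\<in>UNIV. \<omega> j t *\<^sub>R column j G)"
    by (intro continuous_intros \<omega>)
  then have cu: "continuous_on {0..1} u" by (rule continuous_on_eq) (simp add: ueq)
  have lin: "M *v (\<Sum>j\<in>UNIV. f j) = (\<Sum>j\<in>UNIV. M *v f j)"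
      for M :: "real^'a::finite^'b::finite" and f :: "'k \<Rightarrow> real^'a"
    by (rule linear_sum[OF matrix_vector_mul_linear])
  have "integral {0..1} (\<lambda>s. \<Phi> (- s) *v (B *v u s))
      = integral {0..1} (\<lambda>s. \<Sum>j\<in>UNIV. \<omega> j s *\<^sub>R (\<Phi> (- s) *v (B *v column j G)))"
    by (intro integral_cong) (simp add: ueq lin matrix_vector_mult_scaleR)
  also have "\<dots> = (\<Sum>j\<in>UNIV. integral {0..1} (\<lambda>s. \<omega> j s *\<^sub>R (\<Phi> (- s) *v (B *v column j G))))"
    by (intro integral_sum integrable_continuous_real continuous_intros \<omega>
        fundamental_continuous_on[OF \<Phi>]) auto
  finally show ?thesis
    unfolding u_def[symmetric] final_output_eq[OF \<Phi> cu]
    by (simp add: matrix_vector_right_distrib lin response_def)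
qed

text \<open>Integration by parts relates the responses to \<open>f\<close> and to its derivative.\<close>

lemma response_by_parts:
  fixes A :: "real^'n::finite^'n"
  assumes \<Phi>: "fundamental A \<Phi>"
    and f: "\<And>s. s \<in> {0..1} \<Longrightarrow> (f has_vector_derivative f' s) (at s within {0..1})"
    and f': "continuous_on {0..1} f'"
  shows "A *v response \<Phi> f v = response \<Phi> f' v + f 0 *\<^sub>R (\<Phi> 1 *v v) - f 1 *\<^sub>R v"
proof -
  have cf: "continuous_on {0..1} f" using f by (rule continuous_on_vector_derivative)
  define X where "X = integral {0..1} (\<lambda>s. f s *\<^sub>R (\<Phi> (- s) *v v))"
  define X' where "X' = integral {0..1} (\<lambda>s. f' s *\<^sub>R (\<Phi> (- s) *v v))"
  have iX: "((\<lambda>s. f s *\<^sub>R (\<Phi> (- s) *v v)) has_integral X) {0..1}"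
    unfolding X_def by (intro integrable_integral integrable_continuous_real continuous_intros cf
        fundamental_continuous_on[OF \<Phi>])
  have iX': "((\<lambda>s. f' s *\<^sub>R (\<Phi> (- s) *v v)) has_integral X') {0..1}"
    unfolding X'_def by (intro integrable_integral integrable_continuous_real continuous_intros f'
        fundamental_continuous_on[OF \<Phi>])
  have "((\<lambda>s. A *v (f s *\<^sub>R (\<Phi> (- s) *v v))) has_integral A *v X) {0..1}"
    using has_integral_linear[OF iX, of "(*v) A"] by (simp add: o_def linear_conv_bounded_linear[symmetric])
  from has_integral_diff[OF iX' this]
  have 1: "((\<lambda>s. f' s *\<^sub>R (\<Phi> (- s) *v v) - A *v (f s *\<^sub>R (\<Phi> (- s) *v v))) has_integral X' - A *v X) {0..1}" .
  have "((\<lambda>s. f s *\<^sub>R (\<Phi> (- s) *v v)) has_vector_derivative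
      f' s *\<^sub>R (\<Phi> (- s) *v v) - A *v (f s *\<^sub>R (\<Phi> (- s) *v v))) (at s within {0..1})"
    if s: "s \<in> {0..1}" for s
  proof -
    have "((\<lambda>s. \<Phi> (- s) *v v) has_vector_derivative \<Phi> (- s) *v 0 + - (A ** \<Phi> (- s)) *v v)
        (at s within {0..1})"
      by (intro matrix_vector_mult_has_vector_derivative fundamental_deriv_neg \<Phi> has_vector_derivative_const)
    moreover have "- (A ** \<Phi> (- s)) *v v = - ((A ** \<Phi> (- s)) *v v)"
      by (rule bounded_bilinear.minus_left[OF bounded_bilinear_matrix_vector_mult])
    ultimately have "((\<lambda>s. \<Phi> (- s) *v v) has_vector_derivative - (A *v (\<Phi> (- s) *v v))) (at s within {0..1})"
      by (simp add: matrix_vector_mul_assoc)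
    moreover have "(f has_real_derivative f' s) (at s within {0..1})"
      using f[OF s] by (simp add: has_real_derivative_iff_has_vector_derivative)
    ultimately show ?thesis
      using has_vector_derivative_scaleR by (fastforce simp: matrix_vector_mult_scaleR)
  qed
  from fundamental_theorem_of_calculus[OF _ this]
  have 2: "((\<lambda>s. f' s *\<^sub>R (\<Phi> (- s) *v v) - A *v (f s *\<^sub>R (\<Phi> (- s) *v v))) has_integral
      f 1 *\<^sub>R (\<Phi> (- 1) *v v) - f 0 *\<^sub>R (\<Phi> (- 0) *v v)) {0..1}" by simp
  have "X' - A *v X = f 1 *\<^sub>R (\<Phi> (- 1) *v v) - f 0 *\<^sub>R v"
    using has_integral_unique[OF 1 2] \<Phi> by (simp add: fundamental_def)
  then have "\<Phi> 1 *v (X' - A *v X) = f 1 *\<^sub>R ((\<Phi> 1 ** \<Phi> (- 1)) *v v) - f 0 *\<^sub>R (\<Phi> 1 *v v)"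
    by (simp add: matrix_vector_mult_diff_distrib matrix_vector_mult_scaleR matrix_vector_mul_assoc)
  moreover have "\<Phi> 1 *v (A *v X) = A *v (\<Phi> 1 *v X)"
    using \<Phi> by (simp add: fundamental_def matrix_vector_mul_assoc)
  ultimately show ?thesis
    using fundamental_inverse[OF \<Phi>, of 1]
    by (simp add: response_def X_def[symmetric] X'_def[symmetric] matrix_vector_mult_diff_distrib
        algebra_simps)
qed

lemma response_add:
  assumes "fundamental A \<Phi>" "continuous_on {0..1} f" "continuous_on {0..1} g"
  shows "response \<Phi> (\<lambda>s. a * f s + b * g s) v = a *\<^sub>R response \<Phi> f v + b *\<^sub>R response \<Phi> g v"
proof -
  note i = integrable_continuous_real
  have "integral {0..1} (\<lambda>s. (a * f s + b * g s) *\<^sub>R (\<Phi> (- s) *v v))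
     = integral {0..1} (\<lambda>s. a *\<^sub>R (f s *\<^sub>R (\<Phi> (- s) *v v)) + b *\<^sub>R (g s *\<^sub>R (\<Phi> (- s) *v v)))"
    by (simp add: algebra_simps)
  also have "\<dots> = a *\<^sub>R integral {0..1} (\<lambda>s. f s *\<^sub>R (\<Phi> (- s) *v v)) + b *\<^sub>R integral {0..1} (\<lambda>s.
      g s *\<^sub>R (\<Phi> (- s) *v v))"
    unfolding integral_cmul[symmetric]
    by (intro integral_add i continuous_intros assms(2,3) fundamental_continuous_on[OF assms(1)])
  finally show ?thesis
    by (simp add: response_def matrix_vector_right_distrib matrix_vector_mult_scaleR)
qed

text \<open>Responses of the system with \<open>A + \<epsilon>\<close> in place of \<open>A\<close> converge as \<open>\<epsilon>\<close> tends to \<open>0\<close>.\<close>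

lemma response_shift_tendsto:
  assumes \<Phi>: "fundamental A \<Phi>" and f: "continuous_on {0..1} f"
  shows "((\<lambda>\<epsilon>. response (\<lambda>t. exp (\<epsilon> * t) *\<^sub>R \<Phi> t) f v) \<longlongrightarrow> response \<Phi> f v) (at 0)"
proof -
  define h where "h \<epsilon> = response (\<lambda>t. exp (\<epsilon> * t) *\<^sub>R \<Phi> t) f v" for \<epsilon>
  have "continuous_on UNIV (\<lambda>\<epsilon>. integral (cbox 0 1) (\<lambda>s. f s *\<^sub>R ((exp (\<epsilon> * - s) *\<^sub>R \<Phi> (- s)) *v v)))"
  proof (rule integral_continuous_on_param)
    have "continuous_on (UNIV \<times> {0..1}) (\<lambda>w :: real \<times> real. \<Phi> (- snd w))"
      by (rule continuous_on_compose2[OF fundamental_continuous_on(1)[OF \<Phi>, of UNIV]])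
          (auto intro!: continuous_intros)
    moreover have "continuous_on (UNIV \<times> {0..1}) (\<lambda>w :: real \<times> real. f (snd w))"
      by (rule continuous_on_compose2[OF f]) (auto intro!: continuous_intros)
    ultimately show "continuous_on (UNIV \<times> cbox 0 1) (\<lambda>(\<epsilon>, s). f s *\<^sub>R ((exp (\<epsilon> * - s) *\<^sub>R \<Phi> (- s)) *v v))"
      unfolding split_beta by (auto intro!: continuous_intros)
  qed
  then have "continuous_on UNIV h"
    unfolding h_def response_def by (auto intro!: continuous_intros)
  then have "(h \<longlongrightarrow> h 0) (at 0)"
    by (simp add: continuous_on_def)
  then show ?thesis by (simp add: h_def[abs_def])
qed

section \<open>Responses as polynomials\<close>

text \<open>Vector- and matrix-valued polynomial functions.\<close>

definition polyvec :: "nat \<Rightarrow> (real^'p::finite \<Rightarrow> real^'n::finite) \<Rightarrow> bool" where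
  "polyvec d V \<longleftrightarrow> (\<forall>i. polyfn d (\<lambda>x. V x $ i))"

definition polymat :: "nat \<Rightarrow> (real^'p::finite \<Rightarrow> real^'n::finite^'m::finite) \<Rightarrow> bool" where
  "polymat d M \<longleftrightarrow> (\<forall>i j. polyfn d (\<lambda>x. M x $ i $ j))"

lemma polyvec_mono: "polyvec d V \<Longrightarrow> d \<le> e \<Longrightarrow> polyvec e V"
  unfolding polyvec_def using polyfn_mono by blast

lemma polyvec_add: "polyvec d V \<Longrightarrow> polyvec d W \<Longrightarrow> polyvec d (\<lambda>x. V x + W x)"
  by (simp add: polyvec_def polyfn_add)

lemma polyvec_diff: "polyvec d V \<Longrightarrow> polyvec d W \<Longrightarrow> polyvec d (\<lambda>x. V x - W x)"
  by (simp add: polyvec_def polyfn_diff)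

lemma polyvec_scale: "polyvec d V \<Longrightarrow> polyvec d (\<lambda>x. c *\<^sub>R V x)"
  by (simp add: polyvec_def polyfn_cmult)

lemma polyvec_scaleR:
  assumes "polyfn a f" "polyvec b V" "a + b \<le> d"
  shows "polyvec d (\<lambda>x. f x *\<^sub>R V x)"
  unfolding polyvec_def using assms
  by (auto simp: polyvec_def intro: polyfn_mult[OF assms(1)])

lemma polyvec_matrix_mult:
  assumes "polymat a M" "polyvec b V" "a + b \<le> d"
  shows "polyvec d (\<lambda>x. M x *v V x)"
  unfolding polyvec_def matrix_vector_mult_def
proof
  fix i
  have "polyfn d (\<lambda>x. \<Sum>j\<in>UNIV. M x $ i $ j * V x $ j)"
    using assms(1,2)
    by (intro polyfn_sum polyfn_mult[OF _ _ assms(3)]) (auto simp: polyvec_def polymat_def)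
  then show "polyfn d (\<lambda>x. (\<chi> i. \<Sum>j\<in>UNIV. M x $ i $ j * V x $ j) $ i)" by simp
qed

text \<open>The degree of a determinant is at most the sum of the degrees of the columns.\<close>

lemma polyfn_det:
  fixes M :: "real^'p::finite \<Rightarrow> real^'n::finite^'n"
  assumes "\<And>i j. polyfn (e j) (\<lambda>x. M x $ i $ j)"
  shows "polyfn (\<Sum>j\<in>UNIV. e j) (\<lambda>x. det (M x))"
  unfolding det_def
proof (intro polyfn_sum)
  fix p :: "'n \<Rightarrow> 'n" assume "p \<in> {p. p permutes UNIV}"
  then have p: "p permutes UNIV" by simp
  have "polyfn (\<Sum>i\<in>UNIV. e (p i)) (\<lambda>x. \<Prod>i\<in>UNIV. M x $ i $ p i)"
    by (intro polyfn_prod assms)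
  also have "(\<Sum>i\<in>UNIV. e (p i)) = (\<Sum>j\<in>UNIV. e j)"
    using sum.permute[OF p, of e] by (simp add: o_def)
  finally show "polyfn (\<Sum>j\<in>UNIV. e j) (\<lambda>x. of_int (sign p) * (\<Prod>i\<in>UNIV. M x $ i $ p i))"
    by (rule polyfn_cmult)
qed

text \<open>
  The numerators in Cramer's rule for \<open>Q y = r\<close>. As there is no division by \<open>det Q\<close>, the matrix
  need not be invertible.
\<close>

definition cramer_vec :: "real^'n::finite^'n \<Rightarrow> real^'n \<Rightarrow> real^'n" where
  "cramer_vec Q r = (\<chi> k. det (\<chi> i j. if j = k then r $ i else Q $ i $ j))"

lemma cramer_vec: "cramer_vec Q (Q *v y) = det Q *\<^sub>R y"
  by (simp add: cramer_vec_def vec_eq_iff cramer_lemma mult.commute)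

lemma polyvec_cramer_vec:
  fixes Q :: "real^'p::finite \<Rightarrow> real^'n::finite^'n"
  assumes "polymat a Q" "polyvec d r"
  shows "polyvec (a * CARD('n) + d) (\<lambda>x. cramer_vec (Q x) (r x))"
  unfolding polyvec_def
proof
  fix k
  define M where "M x = (\<chi> i j. if j = k then r x $ i else Q x $ i $ j)" for x
  have "polyfn (\<Sum>j\<in>UNIV. a + (if j = k then d else 0)) (\<lambda>x. det (M x))"
  proof (rule polyfn_det)
    fix i j
    show "polyfn (a + (if j = k then d else 0)) (\<lambda>x. M x $ i $ j)"
      using assms polyfn_mono[of d _ "a + d"] by (cases "j = k") (auto simp: M_def polyvec_def polymat_def)
  qed
  moreover have "(\<Sum>j\<in>UNIV. a + (if j = k then d else 0)) = a * CARD('n) + d"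
    by (simp add: sum.distrib mult.commute)
  ultimately show "polyfn (a * CARD('n) + d) (\<lambda>x. cramer_vec (Q x) (r x) $ k)"
    by (simp add: cramer_vec_def M_def)
qed

text \<open>
  The matrix \<open>(A - \<alpha>)\<^sup>2 + \<beta>\<^sup>2\<close>. It is singular exactly when \<open>\<alpha> + i\<beta>\<close> is an eigenvalue of \<open>A\<close>, that
  is, when the input is in resonance with the system.
\<close>

definition resonance :: "real \<Rightarrow> real \<Rightarrow> real^'n::finite^'n \<Rightarrow> real^'n^'n" where
  "resonance \<alpha> \<beta> A = (A - mat \<alpha>) ** (A - mat \<alpha>) + mat (\<beta>\<^sup>2)"

lemma mat_mult_vec: "mat c *v (v :: real^'n::finite) = c *\<^sub>R v"
  by (simp add: vec_eq_iff matrix_vector_mult_def mat_def if_distrib[of "\<lambda>x. x * _"] cong: if_cong)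

lemma resonance_mult:
  "resonance \<alpha> \<beta> A *v y = (A - mat \<alpha>) *v ((A - mat \<alpha>) *v y) + \<beta>\<^sup>2 *\<^sub>R y"
  by (simp add: resonance_def matrix_vector_mult_add_rdistrib matrix_vector_mul_assoc mat_mult_vec)

lemma polymat_shift: "polymat d A \<Longrightarrow> polymat d (\<lambda>x. A x - mat \<alpha>)"
  by (simp add: polymat_def polyfn_diff polyfn_const)

lemma polymat_resonance:
  fixes A :: "real^'p::finite \<Rightarrow> real^'n::finite^'n"
  assumes "polymat 1 A"
  shows "polymat 2 (\<lambda>x. resonance \<alpha> \<beta> (A x))"
proof -
  have "polyfn 2 (\<lambda>x. (\<Sum>k\<in>UNIV. (A x - mat \<alpha>) $ i $ k * (A x - mat \<alpha>) $ k $ j) + mat (\<beta>\<^sup>2) $ i $ j)" for i j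
    by (intro polyfn_add polyfn_sum polyfn_const polyfn_mult[of 1 _ 1]
        polymat_shift[OF assms, unfolded polymat_def, rule_format]) auto
  then show ?thesis by (simp add: polymat_def resonance_def matrix_matrix_mult_def)
qed

lemma polyfn_det_resonance:
  fixes A :: "real^'p::finite \<Rightarrow> real^'n::finite^'n"
  assumes "polymat 1 A"
  shows "polyfn (2 * CARD('n)) (\<lambda>x. det (resonance \<alpha> \<beta> (A x)))"
  using polyfn_det[of "\<lambda>_. 2" "\<lambda>x. resonance \<alpha> \<beta> (A x)"] polymat_resonance[OF assms, of \<alpha> \<beta>]
  by (simp add: polymat_def mult.commute)

text \<open>
  Elimination of \<open>y\<^sub>s\<close>, respectively \<open>y\<^sub>c\<close>, from \<open>(A - \<alpha>) y\<^sub>c + \<beta> y\<^sub>s = r\<^sub>c\<close> and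
  \<open>(A - \<alpha>) y\<^sub>s - \<beta> y\<^sub>c = r\<^sub>s\<close> leaves systems with the resonance matrix. If the right-hand sides
  become polynomial on multiplication by the \<open>k\<close>-th power of its determinant, then the solutions
  become polynomial on multiplication by the next power.
\<close>

lemma resonance_solve:
  fixes A :: "real^'p::finite \<Rightarrow> real^'n::finite^'n"
  assumes A: "polymat 1 A" and "polyvec d Rc" "polyvec d Rs"
  shows "\<exists>Pc Ps. polyvec (2 * CARD('n) + 1 + d) Pc \<and> polyvec (2 * CARD('n) + 1 + d) Ps \<and>
    (\<forall>x yc ys k. det (resonance \<alpha> \<beta> (A x)) ^ k *\<^sub>R ((A x - mat \<alpha>) *v yc + \<beta> *\<^sub>R ys) = Rc x \<longrightarrow>
        det (resonance \<alpha> \<beta> (A x)) ^ k *\<^sub>R ((A x - mat \<alpha>) *v ys - \<beta> *\<^sub>R yc) = Rs x \<longrightarrow>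
        det (resonance \<alpha> \<beta> (A x)) ^ Suc k *\<^sub>R yc = Pc x \<and>
        det (resonance \<alpha> \<beta> (A x)) ^ Suc k *\<^sub>R ys = Ps x)"
proof -
  let ?Q = "\<lambda>x. resonance \<alpha> \<beta> (A x)" and ?M = "\<lambda>x. A x - mat \<alpha>"
  define Pc where "Pc x = cramer_vec (?Q x) (?M x *v Rc x - \<beta> *\<^sub>R Rs x)" for x
  define Ps where "Ps x = cramer_vec (?Q x) (?M x *v Rs x + \<beta> *\<^sub>R Rc x)" for x
  have r: "polyvec (1 + d) (\<lambda>x. ?M x *v Rc x - \<beta> *\<^sub>R Rs x)" "polyvec (1 + d) (\<lambda>x. ?M x *v Rs x + \<beta> *\<^sub>R Rc x)"
    using assms polyvec_mono[of d _ "1 + d"]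
    by (auto intro!: polyvec_diff polyvec_add polyvec_scale polyvec_matrix_mult[OF polymat_shift[OF A]])
  have "polyvec (2 * CARD('n) + (1 + d)) Pc"
    unfolding Pc_def by (rule polyvec_cramer_vec[OF polymat_resonance[OF A] r(1)])
  moreover have "polyvec (2 * CARD('n) + (1 + d)) Ps"
    unfolding Ps_def by (rule polyvec_cramer_vec[OF polymat_resonance[OF A] r(2)])
  moreover have "det (?Q x) ^ Suc k *\<^sub>R yc = Pc x \<and> det (?Q x) ^ Suc k *\<^sub>R ys = Ps x"
    if c: "det (?Q x) ^ k *\<^sub>R (?M x *v yc + \<beta> *\<^sub>R ys) = Rc x"
      and s: "det (?Q x) ^ k *\<^sub>R (?M x *v ys - \<beta> *\<^sub>R yc) = Rs x" for x yc ys k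
  proof -
    define D where "D = det (?Q x) ^ k"
    note dist = matrix_vector_right_distrib matrix_vector_mult_diff_distrib matrix_vector_mult_scaleR
    have "?M x *v Rc x - \<beta> *\<^sub>R Rs x = ?Q x *v (D *\<^sub>R yc)"
      unfolding c[symmetric] s[symmetric] D_def[symmetric] resonance_mult
      by (simp add: dist power2_eq_square algebra_simps)
    moreover have "?M x *v Rs x + \<beta> *\<^sub>R Rc x = ?Q x *v (D *\<^sub>R ys)"
      unfolding c[symmetric] s[symmetric] D_def[symmetric] resonance_mult
      by (simp add: dist power2_eq_square algebra_simps)
    ultimately show ?thesis by (simp add: Pc_def Ps_def cramer_vec D_def)
  qed
  ultimately show ?thesis by (intro exI[of _ Pc] exI[of _ Ps]) (auto simp: add.assoc)
qed

text \<open>The two families of basis functions, on the whole real line.\<close>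

definition cos_mode :: "nat \<Rightarrow> real \<Rightarrow> real \<Rightarrow> real \<Rightarrow> real" where
  "cos_mode l \<alpha> \<beta> t = t ^ l * exp (\<alpha> * t) * cos (\<beta> * t)"

definition sin_mode :: "nat \<Rightarrow> real \<Rightarrow> real \<Rightarrow> real \<Rightarrow> real" where
  "sin_mode l \<alpha> \<beta> t = t ^ l * exp (\<alpha> * t) * sin (\<beta> * t)"

lemma modes_continuous_on: "continuous_on S (cos_mode l \<alpha> \<beta>)" "continuous_on S (sin_mode l \<alpha> \<beta>)"
  unfolding cos_mode_def[abs_def] sin_mode_def[abs_def] by (auto intro!: continuous_intros)

lemma modes_deriv:
  "(cos_mode l \<alpha> \<beta> has_vector_derivative
     1 * (real l * cos_mode (l - 1) \<alpha> \<beta> t) + 1 * (\<alpha> * cos_mode l \<alpha> \<beta> t + - \<beta> * sin_mode l \<alpha> \<beta> t))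
         (at t within S)"
  "(sin_mode l \<alpha> \<beta> has_vector_derivative
     1 * (real l * sin_mode (l - 1) \<alpha> \<beta> t) + 1 * (\<alpha> * sin_mode l \<alpha> \<beta> t + \<beta> * cos_mode l \<alpha> \<beta> t))
         (at t within S)"
  unfolding has_real_derivative_iff_has_vector_derivative[symmetric] cos_mode_def[abs_def]
      sin_mode_def[abs_def]
  by (auto intro!: derivative_eq_intros simp: algebra_simps)

text \<open>
  The terms with \<open>l - 1\<close> carry the factor \<open>l\<close>, so that the truncated subtraction does no harm for
  \<open>l = 0\<close>.
\<close>

lemma modes_by_parts:
  fixes A :: "real^'n::finite^'n" and v :: "real^'n" and \<alpha> \<beta> :: real and l :: nat
  assumes \<Phi>: "fundamental A \<Phi>"
  defines "yc \<equiv> \<lambda>l. response \<Phi> (cos_mode l \<alpha> \<beta>) v" and "ys \<equiv> \<lambda>l. response \<Phi> (sin_mode l \<alpha> \<beta>) v"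
  shows "(A - mat \<alpha>) *v yc l + \<beta> *\<^sub>R ys l =
      real l *\<^sub>R yc (l - 1) + (cos_mode l \<alpha> \<beta> 0 *\<^sub>R (\<Phi> 1 *v v) - cos_mode l \<alpha> \<beta> 1 *\<^sub>R v)"
    and "(A - mat \<alpha>) *v ys l - \<beta> *\<^sub>R yc l =
      real l *\<^sub>R ys (l - 1) + (sin_mode l \<alpha> \<beta> 0 *\<^sub>R (\<Phi> 1 *v v) - sin_mode l \<alpha> \<beta> 1 *\<^sub>R v)"
proof -
  note cont = modes_continuous_on[of "{0..1}" _ \<alpha> \<beta>]
  have shift: "(A - mat \<alpha>) *v y = A *v y - \<alpha> *\<^sub>R y" for y :: "real^'n"
    by (simp add: matrix_vector_mult_diff_rdistrib mat_mult_vec)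
  have ra: "response \<Phi> (\<lambda>s. 1 * (real l * f s) + 1 * (a * g s + b * h s)) v
      = real l *\<^sub>R response \<Phi> f v + (a *\<^sub>R response \<Phi> g v + b *\<^sub>R response \<Phi> h v)"
    if "continuous_on {0..1} f" "continuous_on {0..1} g" "continuous_on {0..1} h" for f g h a b
  proof -
    have "response \<Phi> (\<lambda>s. real l * f s + 0 * f s) v = real l *\<^sub>R response \<Phi> f v + 0 *\<^sub>R response \<Phi> f v"
      by (rule response_add[OF \<Phi> that(1,1)])
    moreover have "response \<Phi> (\<lambda>s. 1 * (real l * f s) + 1 * (a * g s + b * h s)) v =
       1 *\<^sub>R response \<Phi> (\<lambda>s. real l * f s) v + 1 *\<^sub>R response \<Phi> (\<lambda>s. a * g s + b * h s) v"
      by (rule response_add[OF \<Phi>]) (intro continuous_intros that)+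
    ultimately show ?thesis using response_add[OF \<Phi> that(2,3), of a b v] by simp
  qed
  have "A *v yc l = real l *\<^sub>R yc (l - 1) + (\<alpha> *\<^sub>R yc l + - \<beta> *\<^sub>R ys l) 
      + cos_mode l \<alpha> \<beta> 0 *\<^sub>R (\<Phi> 1 *v v) - cos_mode l \<alpha> \<beta> 1 *\<^sub>R v"
    unfolding yc_def ys_def ra[OF cont(1,1,2), symmetric]
    by (rule response_by_parts[OF \<Phi> modes_deriv(1)]) (intro continuous_intros cont)
  then show "(A - mat \<alpha>) *v yc l + \<beta> *\<^sub>R ys l =
      real l *\<^sub>R yc (l - 1) + (cos_mode l \<alpha> \<beta> 0 *\<^sub>R (\<Phi> 1 *v v) - cos_mode l \<alpha> \<beta> 1 *\<^sub>R v)"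
    by (simp add: shift mat_mult_vec algebra_simps)
  have "A *v ys l = real l *\<^sub>R ys (l - 1) + (\<alpha> *\<^sub>R ys l + \<beta> *\<^sub>R yc l) 
      + sin_mode l \<alpha> \<beta> 0 *\<^sub>R (\<Phi> 1 *v v) - sin_mode l \<alpha> \<beta> 1 *\<^sub>R v"
    unfolding yc_def ys_def ra[OF cont(2,2,1), symmetric]
    by (rule response_by_parts[OF \<Phi> modes_deriv(2)]) (intro continuous_intros cont)
  then show "(A - mat \<alpha>) *v ys l - \<beta> *\<^sub>R yc l =
      real l *\<^sub>R ys (l - 1) + (sin_mode l \<alpha> \<beta> 0 *\<^sub>R (\<Phi> 1 *v v) - sin_mode l \<alpha> \<beta> 1 *\<^sub>R v)"
    by (simp add: shift mat_mult_vec algebra_simps)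
qed

text \<open>
  Induction on \<open>l\<close>: each step costs one more determinant and raises the degree by \<open>2n + 1\<close>. The
  matrix \<open>E x\<close> stands for the exponential of \<open>A x\<close>, but it is an arbitrary polynomial matrix of
  degree one.
\<close>

lemma mode_response_polynomial:
  fixes A E :: "real^'p::finite \<Rightarrow> real^'n::finite^'n" and v :: "real^'p \<Rightarrow> real^'n"
  assumes A: "polymat 1 A" and E: "polymat 1 E" and v: "polyvec 1 v"
  shows "\<exists>Pc Ps. polyvec ((2 * CARD('n) + 1) * Suc l + 2) Pc \<and> polyvec ((2 * CARD('n) + 1) * Suc l + 2) Ps \<and>
    (\<forall>x \<Phi>. fundamental (A x) \<Phi> \<longrightarrow> \<Phi> 1 = E x \<longrightarrow>
        det (resonance \<alpha> \<beta> (A x)) ^ Suc l *\<^sub>R response \<Phi> (cos_mode l \<alpha> \<beta>) (v x) = Pc x \<and>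
        det (resonance \<alpha> \<beta> (A x)) ^ Suc l *\<^sub>R response \<Phi> (sin_mode l \<alpha> \<beta>) (v x) = Ps x)"
proof (induction l)
  case 0
  define W where "W f x = f 0 *\<^sub>R (E x *v v x) - f 1 *\<^sub>R v x" for f :: "real \<Rightarrow> real" and x
  have W: "polyvec 2 (W f)" for f
    unfolding W_def by (intro polyvec_diff polyvec_scale polyvec_matrix_mult[OF E v] polyvec_mono[OF v]) auto
  obtain Pc Ps where P: "polyvec (2 * CARD('n) + 1 + 2) Pc" "polyvec (2 * CARD('n) + 1 + 2) Ps"
    "\<forall>x yc ys k. det (resonance \<alpha> \<beta> (A x)) ^ k *\<^sub>R ((A x - mat \<alpha>) *v yc + \<beta> *\<^sub>R ys) = W (cos_mode 0 \<alpha> \<beta>) x \<longrightarrow>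
        det (resonance \<alpha> \<beta> (A x)) ^ k *\<^sub>R ((A x - mat \<alpha>) *v ys - \<beta> *\<^sub>R yc) = W (sin_mode 0 \<alpha> \<beta>) x \<longrightarrow>
        det (resonance \<alpha> \<beta> (A x)) ^ Suc k *\<^sub>R yc = Pc x \<and>
        det (resonance \<alpha> \<beta> (A x)) ^ Suc k *\<^sub>R ys = Ps x"
    using resonance_solve[OF A W[of "cos_mode 0 \<alpha> \<beta>"] W[of "sin_mode 0 \<alpha> \<beta>"],
        where \<alpha> = \<alpha> and \<beta> = \<beta>] by (elim exE conjE)
  have "det (resonance \<alpha> \<beta> (A x)) ^ Suc 0 *\<^sub>R response \<Phi> (cos_mode 0 \<alpha> \<beta>) (v x) = Pc x \<and>
        det (resonance \<alpha> \<beta> (A x)) ^ Suc 0 *\<^sub>R response \<Phi> (sin_mode 0 \<alpha> \<beta>) (v x) = Ps x"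
    if "fundamental (A x) \<Phi>" "\<Phi> 1 = E x" for x \<Phi>
    by (rule P(3)[rule_format]) (use modes_by_parts[OF that(1),
        where \<alpha> = \<alpha> and \<beta> = \<beta> and v = "v x" and l = 0] that(2) in \<open>simp_all add: W_def\<close>)
  with P(1,2) show ?case by (intro exI[of _ Pc] exI[of _ Ps]) auto
next
  case (Suc l)
  let ?d = "(2 * CARD('n) + 1) * Suc l + 2"
  let ?D = "\<lambda>x. det (resonance \<alpha> \<beta> (A x)) ^ Suc l"
  obtain Pc Ps where P: "polyvec ?d Pc" "polyvec ?d Ps"
    "\<forall>x \<Phi>. fundamental (A x) \<Phi> \<longrightarrow> \<Phi> 1 = E x \<longrightarrow>
        ?D x *\<^sub>R response \<Phi> (cos_mode l \<alpha> \<beta>) (v x) = Pc x \<and> ?D x *\<^sub>R response \<Phi> (sin_mode l \<alpha> \<beta>) (v x) = Ps x"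
    using Suc.IH by (elim exE conjE)
  define W where "W P f x = real (Suc l) *\<^sub>R P x + ?D x *\<^sub>R (f 0 *\<^sub>R (E x *v v x) - f 1 *\<^sub>R v x)"
    for P :: "real^'p \<Rightarrow> real^'n" and f :: "real \<Rightarrow> real" and x
  have W: "polyvec ?d (W P f)" if "polyvec ?d P" for P f
  proof -
    have 1: "polyvec 2 (\<lambda>x. f 0 *\<^sub>R (E x *v v x) - f 1 *\<^sub>R v x)"
      by (intro polyvec_diff polyvec_scale polyvec_matrix_mult[OF E v] polyvec_mono[OF v]) auto
    have 2: "polyfn (Suc l * (2 * CARD('n))) ?D"
      by (intro polyfn_power polyfn_det_resonance A)
    have "polyvec ?d (\<lambda>x. ?D x *\<^sub>R (f 0 *\<^sub>R (E x *v v x) - f 1 *\<^sub>R v x))"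
      by (rule polyvec_scaleR[OF 2 1]) (simp add: algebra_simps)
    then show ?thesis unfolding W_def by (intro polyvec_add polyvec_scale that)
  qed
  obtain Qc Qs where Q: "polyvec (2 * CARD('n) + 1 + ?d) Qc" "polyvec (2 * CARD('n) + 1 + ?d) Qs"
    "\<forall>x yc ys k. det (resonance \<alpha> \<beta> (A x)) ^ k *\<^sub>R ((A x - mat \<alpha>) *v yc + \<beta> *\<^sub>R ys)
        = W Pc (cos_mode (Suc l) \<alpha> \<beta>) x \<longrightarrow>
        det (resonance \<alpha> \<beta> (A x)) ^ k *\<^sub>R ((A x - mat \<alpha>) *v ys - \<beta> *\<^sub>R yc) = W Ps (sin_mode (Suc l) \<alpha> \<beta>) x \<longrightarrow>
        det (resonance \<alpha> \<beta> (A x)) ^ Suc k *\<^sub>R yc = Qc x \<and>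
        det (resonance \<alpha> \<beta> (A x)) ^ Suc k *\<^sub>R ys = Qs x"
    using resonance_solve[OF A W[OF P(1), of "cos_mode (Suc l) \<alpha> \<beta>"] W[OF P(2), of "sin_mode (Suc
        l) \<alpha> \<beta>"], where \<alpha> = \<alpha> and \<beta> = \<beta>]
    by (elim exE conjE)
  have "det (resonance \<alpha> \<beta> (A x)) ^ Suc (Suc l) *\<^sub>R response \<Phi> (cos_mode (Suc l) \<alpha> \<beta>) (v x) = Qc x \<and>
        det (resonance \<alpha> \<beta> (A x)) ^ Suc (Suc l) *\<^sub>R response \<Phi> (sin_mode (Suc l) \<alpha> \<beta>) (v x) = Qs x"
    if \<Phi>: "fundamental (A x) \<Phi>" "\<Phi> 1 = E x" for x \<Phi>
  proof (rule Q(3)[rule_format])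
    note IH = P(3)[rule_format, OF \<Phi>]
    show "?D x *\<^sub>R ((A x - mat \<alpha>) *v response \<Phi> (cos_mode (Suc l) \<alpha> \<beta>) (v x)
        + \<beta> *\<^sub>R response \<Phi> (sin_mode (Suc l) \<alpha> \<beta>) (v x))
        = W Pc (cos_mode (Suc l) \<alpha> \<beta>) x"
      unfolding modes_by_parts[OF \<Phi>(1)] W_def conjunct1[OF IH, symmetric] \<Phi>(2)
      by (simp only: scaleR_add_right diff_Suc_1) (simp add: mult.commute)
    show "?D x *\<^sub>R ((A x - mat \<alpha>) *v response \<Phi> (sin_mode (Suc l) \<alpha> \<beta>) (v x) - \<beta> *\<^sub>R response \<Phi>
        (cos_mode (Suc l) \<alpha> \<beta>) (v x))
        = W Ps (sin_mode (Suc l) \<alpha> \<beta>) x"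
      unfolding modes_by_parts[OF \<Phi>(1)] W_def conjunct2[OF IH, symmetric] \<Phi>(2)
      by (simp only: scaleR_add_right diff_Suc_1) (simp add: mult.commute)
  qed
  moreover have "2 * CARD('n) + 1 + ?d = (2 * CARD('n) + 1) * Suc (Suc l) + 2" by simp
  ultimately show ?case using Q(1,2) by (intro exI[of _ Qc] exI[of _ Qs]) metis
qed

lemma response_cong:
  "(\<And>s. s \<in> {0..1} \<Longrightarrow> f s = g s) \<Longrightarrow> response \<Phi> f v = response \<Phi> g v"
  unfolding response_def by (rule arg_cong[where f = "(*v) (\<Phi> 1)"], rule integral_cong) auto

text \<open>
  The determinant is a polynomial in \<open>\<epsilon>\<close>. It is not zero, because for large \<open>\<epsilon>\<close> the term \<open>\<epsilon>\<^sup>2\<close>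
  dominates the other terms of the matrix.
\<close>

lemma det_shift_eventually_nonzero:
  fixes A :: "real^'n::finite^'n"
  shows "eventually (\<lambda>\<epsilon>. det (resonance \<alpha> \<beta> (A + mat \<epsilon>)) \<noteq> 0) (at 0)"
proof -
  define A' where "A' = A - mat \<alpha>"
  define W where "W = A' ** A' + mat (\<beta>\<^sup>2)"
  have mm: "mat (c :: real) = c *\<^sub>R (mat 1 :: real^'n^'n)" for c by (simp add: mat_def vec_eq_iff)
  have eq: "resonance \<alpha> \<beta> (A + mat \<epsilon>) = \<epsilon>\<^sup>2 *\<^sub>R mat 1 + (2 * \<epsilon>) *\<^sub>R A' + W" for \<epsilon>
  proof -
    have "A + mat \<epsilon> - mat \<alpha> = A' + \<epsilon> *\<^sub>R mat 1" by (simp add: A'_def mm[of \<epsilon>])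
    then show ?thesis
      by (simp add: resonance_def W_def matrix_add_ldistrib matrix_add_rdistrib matrix_scalar_ac
          scalar_matrix_assoc[symmetric] power2_eq_square scaleR_2[symmetric] algebra_simps)
         (simp add: scaleR_2 algebra_simps flip: scaleR_scaleR)
  qed
  define p where "p i j = [: W $ i $ j, 2 * A' $ i $ j, mat 1 $ i $ j :]" for i j
  define q where "q = (\<Sum>\<pi> | \<pi> permutes (UNIV :: 'n set). smult (of_int (sign \<pi>)) (\<Prod>i\<in>UNIV. p i (\<pi> i)))"
  have det: "det (resonance \<alpha> \<beta> (A + mat \<epsilon>)) = poly q \<epsilon>" for \<epsilon>
    unfolding eq det_def q_def
    by (simp add: poly_sum poly_prod p_def power2_eq_square algebra_simps)
  obtain K where K': "0 < K \<and> (\<forall>(M :: real^'n^'n) (v :: real^'n). norm (M *v v) \<le> norm M * norm v * K)"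
    using bounded_bilinear.pos_bounded[OF bounded_bilinear_matrix_vector_mult[where 'n='n and 'm='n]] ..
  then have K: "0 < K" "norm (M *v v) \<le> norm M * norm v * K" for M :: "real^'n^'n" and v by simp_all
  define a where "a = norm A' * K"
  define b where "b = norm W * K"
  have ab: "0 \<le> a" "0 \<le> b" using K(1) by (simp_all add: a_def b_def)
  define \<epsilon> where "\<epsilon> = 2 * a + b + 1"
  have "\<epsilon> * 1 \<le> \<epsilon> * (b + 1)" using ab by (intro mult_left_mono) (auto simp: \<epsilon>_def)
  then have big: "2 * \<epsilon> * a + b < \<epsilon>\<^sup>2"
    using ab by (simp add: \<epsilon>_def power2_eq_square algebra_simps) (smt (verit) mult_nonneg_nonneg)
  have "v = 0" if v: "resonance \<alpha> \<beta> (A + mat \<epsilon>) *v v = 0" for v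
  proof (rule ccontr)
    assume "v \<noteq> 0"
    have "\<epsilon>\<^sup>2 *\<^sub>R v = - ((2 * \<epsilon>) *\<^sub>R (A' *v v) + W *v v)"
      using v unfolding eq
      by (simp add: matrix_vector_mult_add_rdistrib scaleR_matrix_vector_assoc[symmetric]
          algebra_simps eq_neg_iff_add_eq_0)
    then have "\<epsilon>\<^sup>2 * norm v = norm ((2 * \<epsilon>) *\<^sub>R (A' *v v) + W *v v)"
      by (metis norm_minus_cancel norm_scaleR abs_power2)
    also have "\<dots> \<le> 2 * \<epsilon> * norm (A' *v v) + norm (W *v v)"
      using ab by (intro order_trans[OF norm_triangle_ineq]) (simp add: \<epsilon>_def)
    also have "\<dots> \<le> 2 * \<epsilon> * (a * norm v) + b * norm v"
      using K(2)[of A' v] K(2)[of W v] ab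
      by (intro add_mono mult_left_mono) (auto simp: a_def b_def mult_ac \<epsilon>_def)
    also have "\<dots> = (2 * \<epsilon> * a + b) * norm v" by (simp add: algebra_simps)
    finally show False using big \<open>v \<noteq> 0\<close> by simp
  qed
  then have "inj ((*v) (resonance \<alpha> \<beta> (A + mat \<epsilon>)))"
    using matrix_left_invertible_ker matrix_left_invertible_injective by blast
  then have "poly q \<epsilon> \<noteq> 0"
    unfolding det[symmetric] by (simp add: matrix_left_invertible_injective[symmetric]
        invertible_det_nz[symmetric] invertible_left_inverse)
  then have "q \<noteq> 0" by auto
  then have "finite {\<epsilon>. poly q \<epsilon> = 0}" by (rule poly_roots_finite)
  then have "eventually (\<lambda>\<epsilon>. \<forall>z\<in>{\<epsilon>. poly q \<epsilon> = 0}. \<epsilon> \<noteq> z) (at 0)"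
    by (intro eventually_ball_finite) (auto intro: eventually_neq_at_within)
  then show ?thesis unfolding det by (rule eventually_mono) auto
qed

section \<open>The parametrisation of final outputs\<close>

text \<open>
  Index type of the parameter vectors that collect the entries of \<open>A\<close>, \<open>E\<close>, \<open>B\<close>, \<open>C\<close> and the scalar
  \<open>c\<close>. On the parameters of actual systems \<open>E\<close> is the exponential of \<open>A\<close>, and \<open>c\<close> is the output
  contributed by the initial state, up to a shift.
\<close>

type_synonym ('n, 'm) par = "('n \<times> 'n) + ('n \<times> 'n) + ('n \<times> 'm) + 'n + unit"

text \<open>The components of a parameter vector.\<close>

definition par_A :: "(real, ('n::finite, 'm::finite) par) vec \<Rightarrow> real^'n^'n" where
  "par_A \<theta> = (\<chi> i j. \<theta> $ Inl (i, j))"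

definition par_E :: "(real, ('n::finite, 'm::finite) par) vec \<Rightarrow> real^'n^'n" where
  "par_E \<theta> = (\<chi> i j. \<theta> $ Inr (Inl (i, j)))"

definition par_B :: "(real, ('n::finite, 'm::finite) par) vec \<Rightarrow> real^'m^'n" where
  "par_B \<theta> = (\<chi> i j. \<theta> $ Inr (Inr (Inl (i, j))))"

definition par_C :: "(real, ('n::finite, 'm::finite) par) vec \<Rightarrow> real^'n" where
  "par_C \<theta> = (\<chi> i. \<theta> $ Inr (Inr (Inr (Inl i))))"

definition par_c :: "(real, ('n::finite, 'm::finite) par) vec \<Rightarrow> real" where
  "par_c \<theta> = \<theta> $ Inr (Inr (Inr (Inr ())))"

lemma par_surj:
  fixes A E :: "real^'n::finite^'n" and B :: "real^'m::finite^'n"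
  shows "\<exists>\<theta>. par_A \<theta> = A \<and> par_E \<theta> = E \<and> par_B \<theta> = B \<and> par_C \<theta> = C \<and> par_c \<theta> = c"
  by (intro exI[of _ "\<chi> i. case i of Inl (a, b) \<Rightarrow> A $ a $ b
        | Inr (Inl (a, b)) \<Rightarrow> E $ a $ b | Inr (Inr (Inl (a, b))) \<Rightarrow> B $ a $ b
        | Inr (Inr (Inr (Inl a))) \<Rightarrow> C $ a | Inr (Inr (Inr (Inr _))) \<Rightarrow> c"])
     (simp add: par_A_def par_E_def par_B_def par_C_def par_c_def vec_eq_iff)

lemma par_polynomial:
  "polymat 1 (par_A :: (real, ('n::finite, 'm::finite) par) vec \<Rightarrow> _)"
  "polymat 1 (par_E :: (real, ('n, 'm) par) vec \<Rightarrow> _)"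
  "polymat 1 (par_B :: (real, ('n, 'm) par) vec \<Rightarrow> _)"
  "polyvec 1 (par_C :: (real, ('n, 'm) par) vec \<Rightarrow> _)"
  "polyfn 1 (par_c :: (real, ('n, 'm) par) vec \<Rightarrow> _)"
  by (simp_all add: polymat_def polyvec_def par_A_def par_E_def par_B_def par_C_def
      par_c_def[abs_def] polyfn_var)

lemma polyvec_matrix_const: "polymat d M \<Longrightarrow> polyvec d (\<lambda>x. M x *v v)"
  using polyvec_matrix_mult[of d M 0 "\<lambda>_. v" d] by (simp add: polyvec_def polyfn_const)

lemma polyfn_inner:
  assumes "polyvec a V" "polyvec b W"
  shows "polyfn (a + b) (\<lambda>x. V x \<bullet> W x)"
  unfolding inner_vec_def
  using assms by (intro polyfn_sum) (auto simp: polyvec_def intro!: polyfn_mult[of a _ b])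

lemma basis_mode:
  assumes "basis_inputs l \<alpha> \<beta> \<omega>"
  shows "(\<forall>t\<in>{0..1}. \<omega> j t = cos_mode (l j) (\<alpha> j) (\<beta> j) t) \<or> (\<forall>t\<in>{0..1}. \<omega> j t
      = sin_mode (l j) (\<alpha> j) (\<beta> j) t)"
proof -
  have "\<omega> j = (\<lambda>t\<in>{0..1}. t ^ l j * exp (\<alpha> j * t) * sin (\<beta> j * t)) \<or>
        \<omega> j = (\<lambda>t\<in>{0..1}. t ^ l j * exp (\<alpha> j * t) * cos (\<beta> j * t))"
    using assms unfolding basis_inputs_def by blast
  then show ?thesis by (elim disjE) (simp_all add: cos_mode_def sin_mode_def)
qed

lemma basis_continuous_on:
  assumes "basis_inputs l \<alpha> \<beta> \<omega>"
  shows "continuous_on {0..1} (\<omega> j)"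
  using basis_mode[OF assms, of j]
proof
  assume "\<forall>t\<in>{0..1}. \<omega> j t = cos_mode (l j) (\<alpha> j) (\<beta> j) t"
  then show ?thesis using continuous_on_eq[OF modes_continuous_on(1)] by metis
next
  assume "\<forall>t\<in>{0..1}. \<omega> j t = sin_mode (l j) (\<alpha> j) (\<beta> j) t"
  then show ?thesis using continuous_on_eq[OF modes_continuous_on(2)] by metis
qed

lemma basis_response_polynomial:
  fixes A E :: "real^'p::finite \<Rightarrow> real^'n::finite^'n" and v :: "real^'p \<Rightarrow> real^'n"
  assumes "basis_inputs l \<alpha> \<beta> \<omega>" "polymat 1 A" "polymat 1 E" "polyvec 1 v"
  shows "\<exists>P. polyvec ((2 * CARD('n) + 1) * Suc (l j) + 2) P \<and>
    (\<forall>x \<Phi>. fundamental (A x) \<Phi> \<longrightarrow> \<Phi> 1 = E x \<longrightarrow>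
        det (resonance (\<alpha> j) (\<beta> j) (A x)) ^ Suc (l j) *\<^sub>R response \<Phi> (\<omega> j) (v x) = P x)"
proof -
  obtain Pc Ps where P: "polyvec ((2 * CARD('n) + 1) * Suc (l j) + 2) Pc" "polyvec ((2 * CARD('n)
      + 1) * Suc (l j) + 2) Ps"
    "\<forall>x \<Phi>. fundamental (A x) \<Phi> \<longrightarrow> \<Phi> 1 = E x \<longrightarrow>
        det (resonance (\<alpha> j) (\<beta> j) (A x)) ^ Suc (l j) *\<^sub>R response \<Phi> (cos_mode (l j) (\<alpha> j) (\<beta> j))
            (v x) = Pc x \<and>
        det (resonance (\<alpha> j) (\<beta> j) (A x)) ^ Suc (l j) *\<^sub>R response \<Phi> (sin_mode (l j) (\<alpha> j) (\<beta> j))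
            (v x) = Ps x"
    using mode_response_polynomial[OF assms(2-4), of "l j" "\<alpha> j" "\<beta> j"] by (elim exE conjE)
  from basis_mode[OF assms(1), of j] show ?thesis
  proof
    assume "\<forall>t\<in>{0..1}. \<omega> j t = cos_mode (l j) (\<alpha> j) (\<beta> j) t"
    then have "response \<Phi> (\<omega> j) w = response \<Phi> (cos_mode (l j) (\<alpha> j) (\<beta> j)) w" for \<Phi> and w :: "real^'n"
      by (intro response_cong) auto
    with P show ?thesis by (intro exI[of _ Pc]) simp
  next
    assume "\<forall>t\<in>{0..1}. \<omega> j t = sin_mode (l j) (\<alpha> j) (\<beta> j) t"
    then have "response \<Phi> (\<omega> j) w = response \<Phi> (sin_mode (l j) (\<alpha> j) (\<beta> j)) w" for \<Phi> and w :: "real^'n"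
      by (intro response_cong) auto
    with P show ?thesis by (intro exI[of _ Ps]) simp
  qed
qed

text \<open>
  The final output times the product of the \<open>2(l\<^sub>j + 1)\<close>-th powers of the determinants. The
  \<open>(l\<^sub>j + 1)\<close>-th powers would suffice to clear the denominators; the exponents are doubled so that
  the factor is positive.
\<close>

lemma output_polynomial:
  fixes l :: "'k::finite \<Rightarrow> nat" and G :: "real^'k^'m::finite"
  assumes \<omega>: "basis_inputs l \<alpha> \<beta> \<omega>"
  shows "\<exists>F :: (real, ('n::finite, 'm) par) vec \<Rightarrow> real.
    polyfn (8 * CARD('n) * CARD('k) * Suc (Max (range l))) F \<and>
    (\<forall>\<theta> \<Phi>. fundamental (par_A \<theta>) \<Phi> \<longrightarrow> \<Phi> 1 = par_E \<theta> \<longrightarrow>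
       F \<theta> = (\<Prod>j\<in>UNIV. det (resonance (\<alpha> j) (\<beta> j) (par_A \<theta>)) ^ (2 * Suc (l j))) *
         (par_c \<theta> + (\<Sum>j\<in>UNIV. par_C \<theta> \<bullet> response \<Phi> (\<omega> j) (par_B \<theta> *v column j G))))"
proof -
  let ?n = "CARD('n)" and ?N = "Suc (Max (range l))"
  define \<delta> :: "'k \<Rightarrow> (real, ('n, 'm) par) vec \<Rightarrow> real" where
    "\<delta> j \<theta> = det (resonance (\<alpha> j) (\<beta> j) (par_A \<theta>))" for j \<theta>
  have p\<delta>: "polyfn (2 * ?n) (\<delta> j)" for j
    unfolding \<delta>_def by (rule polyfn_det_resonance[OF par_polynomial(1)])
  define T where "T I = (\<Sum>i\<in>I. 2 * Suc (l i) * (2 * ?n))" for I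
  have pprod: "polyfn (T I) (\<lambda>\<theta>. \<Prod>i\<in>I. \<delta> i \<theta> ^ (2 * Suc (l i)))" for I
    unfolding T_def by (intro polyfn_prod polyfn_power p\<delta>)
  have "\<forall>j. \<exists>P. polyvec ((2 * ?n + 1) * Suc (l j) + 2) P \<and>
    (\<forall>(\<theta> :: (real, ('n, 'm) par) vec) \<Phi>. fundamental (par_A \<theta>) \<Phi> \<longrightarrow> \<Phi> 1 = par_E \<theta> \<longrightarrow>
        \<delta> j \<theta> ^ Suc (l j) *\<^sub>R response \<Phi> (\<omega> j) (par_B \<theta> *v column j G) = P \<theta>)"
    unfolding \<delta>_def
    by (intro allI basis_response_polynomial[OF \<omega> par_polynomial(1,2)] polyvec_matrix_const par_polynomial)
  then obtain P where P': "\<forall>j. polyvec ((2 * ?n + 1) * Suc (l j) + 2) (P j) \<and>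
    (\<forall>(\<theta> :: (real, ('n, 'm) par) vec) \<Phi>. fundamental (par_A \<theta>) \<Phi> \<longrightarrow> \<Phi> 1 = par_E \<theta> \<longrightarrow>
        \<delta> j \<theta> ^ Suc (l j) *\<^sub>R response \<Phi> (\<omega> j) (par_B \<theta> *v column j G) = P j \<theta>)"
    by (rule choice[THEN exE])
  then have P: "polyvec ((2 * ?n + 1) * Suc (l j) + 2) (P j)"
    "fundamental (par_A \<theta>) \<Phi> \<Longrightarrow> \<Phi> 1 = par_E \<theta> \<Longrightarrow>
        \<delta> j \<theta> ^ Suc (l j) *\<^sub>R response \<Phi> (\<omega> j) (par_B \<theta> *v column j G) = P j \<theta>" for j \<theta> \<Phi>
    by simp_all
  define F where "F \<theta> = (\<Prod>j\<in>UNIV. \<delta> j \<theta> ^ (2 * Suc (l j))) * par_c \<theta> +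
    (\<Sum>j\<in>UNIV. (\<Prod>i\<in>UNIV - {j}. \<delta> i \<theta> ^ (2 * Suc (l i))) * (\<delta> j \<theta> ^ Suc (l j) * (par_C \<theta> \<bullet> P j \<theta>)))" for \<theta>
  have lj: "Suc (l j) \<le> ?N" for j by simp
  have "T UNIV \<le> (\<Sum>i\<in>(UNIV :: 'k set). 2 * ?N * (2 * ?n))"
    unfolding T_def by (intro sum_mono mult_le_mono lj le_refl)
  then have T: "T UNIV \<le> 4 * ?n * CARD('k) * ?N" by (simp add: algebra_simps)
  have "1 * 1 * ?N \<le> ?n * CARD('k) * ?N"
    by (intro mult_le_mono le_refl) (simp_all add: Suc_le_eq)
  then have N: "?N + 3 \<le> 4 * ?n * CARD('k) * ?N" by simp
  let ?d = "8 * ?n * CARD('k) * ?N"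
  have "polyfn ?d F"
    unfolding F_def
  proof (intro polyfn_add polyfn_sum)
    show "polyfn ?d (\<lambda>\<theta>. (\<Prod>j\<in>UNIV. \<delta> j \<theta> ^ (2 * Suc (l j))) * par_c \<theta>)"
      by (rule polyfn_mult[OF pprod par_polynomial(5)]) (use T N in linarith)
    fix j
    have split: "T UNIV = T (UNIV - {j}) + 2 * Suc (l j) * (2 * ?n)"
      unfolding T_def by (subst sum.remove[of _ j]) auto
    then have d: "T (UNIV - {j}) + (Suc (l j) * (2 * ?n) + (1 + ((2 * ?n + 1) * Suc (l j) + 2))) \<le> ?d"
    proof -
      have "Suc (l j) * (2 * ?n) + (1 + ((2 * ?n + 1) * Suc (l j) + 2)) = 2 * Suc (l j) * (2 * ?n)
          + Suc (l j) + 3"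
        by (simp add: algebra_simps)
      then show ?thesis using split T N lj[of j] by linarith
    qed
    have 1: "polyfn (Suc (l j) * (2 * ?n)) (\<lambda>\<theta>. \<delta> j \<theta> ^ Suc (l j))" by (intro polyfn_power p\<delta>)
    have 2: "polyfn (1 + ((2 * ?n + 1) * Suc (l j) + 2)) (\<lambda>\<theta>. par_C \<theta> \<bullet> P j \<theta>)"
      by (intro polyfn_inner par_polynomial P)
    show "polyfn ?d (\<lambda>\<theta>. (\<Prod>i\<in>UNIV - {j}. \<delta> i \<theta> ^ (2 * Suc (l i))) * (\<delta> j \<theta> ^ Suc (l j) * (par_C \<theta> \<bullet> P j \<theta>)))"
      by (rule polyfn_mult[OF pprod polyfn_mult[OF 1 2 order_refl] d])
  qed
  moreover have "F \<theta> = (\<Prod>j\<in>UNIV. \<delta> j \<theta> ^ (2 * Suc (l j))) *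
         (par_c \<theta> + (\<Sum>j\<in>UNIV. par_C \<theta> \<bullet> response \<Phi> (\<omega> j) (par_B \<theta> *v column j G)))"
    if \<Phi>: "fundamental (par_A \<theta>) \<Phi>" "\<Phi> 1 = par_E \<theta>" for \<theta> \<Phi>
  proof -
    have "(\<Prod>i\<in>UNIV - {j}. \<delta> i \<theta> ^ (2 * Suc (l i))) * (\<delta> j \<theta> ^ Suc (l j) * (par_C \<theta> \<bullet> P j \<theta>))
      = (\<Prod>i\<in>UNIV. \<delta> i \<theta> ^ (2 * Suc (l i))) * (par_C \<theta> \<bullet> response \<Phi> (\<omega> j) (par_B \<theta> *v column j G))" for j
    proof -
      have "(\<Prod>i\<in>UNIV. \<delta> i \<theta> ^ (2 * Suc (l i))) = (\<delta> j \<theta> ^ Suc (l j) * \<delta> j \<theta> ^ Suc (l j)) * (\<Prod>i\<in>UNIV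
          - {j}. \<delta> i \<theta> ^ (2 * Suc (l i)))"
        by (subst prod.remove[of _ j]) (simp_all only: finite UNIV_I mult_2 power_add)
      then show ?thesis by (simp only: P(2)[OF \<Phi>, symmetric] inner_scaleR_right mult_ac)
    qed
    then show ?thesis by (simp only: F_def distrib_left sum_distrib_left)
  qed
  ultimately show ?thesis unfolding \<delta>_def by (intro exI[of _ F]) simp
qed

text \<open>
  Each subset of \<open>D\<close> is cut out by a system. Lowering its constant \<open>c\<close> by a small \<open>\<eta>\<close> turns the
  condition \<open>y \<le> 0\<close> into \<open>y < 0\<close> without loss of the positive outputs; then \<open>A\<close> is moved off
  resonance.
\<close>

lemma shattered_card_bound:
  fixes l :: "'k::finite \<Rightarrow> nat" and D :: "(real \<Rightarrow> real^'m::finite) set"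
  assumes \<omega>: "basis_inputs l \<alpha> \<beta> \<omega>" and D: "finite D" "D \<subseteq> input_space \<omega>"
    and sh: "shattered (sign_concept_class TYPE('n::finite) \<omega>) D"
  shows "2 ^ card D \<le> (card D * (8 * CARD('n) * CARD('k) * Suc (Max (range l))) + 2)
           ^ (2 * CARD('n)\<^sup>2 + CARD('n) * CARD('m) + CARD('n) + 1)"
proof -
  let ?d = "8 * CARD('n) * CARD('k) * Suc (Max (range l))"
  have "\<forall>u\<in>D. \<exists>G :: real^'k^'m. u = (\<lambda>t\<in>{0..1}. G *v (\<chi> j. \<omega> j t))"
    using D(2) by (auto simp: input_space_def)
  then obtain G :: "(real \<Rightarrow> real^'m) \<Rightarrow> real^'k^'m" where
    G: "\<And>u. u \<in> D \<Longrightarrow> u = (\<lambda>t\<in>{0..1}. G u *v (\<chi> j. \<omega> j t))"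
    by (elim bchoice[THEN exE]) blast
  have "\<forall>u. \<exists>F :: (real, ('n, 'm) par) vec \<Rightarrow> real. polyfn ?d F \<and>
    (\<forall>\<theta> \<Phi>. fundamental (par_A \<theta>) \<Phi> \<longrightarrow> \<Phi> 1 = par_E \<theta> \<longrightarrow>
       F \<theta> = (\<Prod>j\<in>UNIV. det (resonance (\<alpha> j) (\<beta> j) (par_A \<theta>)) ^ (2 * Suc (l j))) *
         (par_c \<theta> + (\<Sum>j\<in>UNIV. par_C \<theta> \<bullet> response \<Phi> (\<omega> j) (par_B \<theta> *v column j (G u)))))"
    by (intro allI output_polynomial[OF \<omega>])
  then obtain F where F': "\<forall>u. polyfn ?d (F u) \<and>
    (\<forall>(\<theta> :: (real, ('n, 'm) par) vec) \<Phi>. fundamental (par_A \<theta>) \<Phi> \<longrightarrow> \<Phi> 1 = par_E \<theta> \<longrightarrow>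
       F u \<theta> = (\<Prod>j\<in>UNIV. det (resonance (\<alpha> j) (\<beta> j) (par_A \<theta>)) ^ (2 * Suc (l j))) *
         (par_c \<theta> + (\<Sum>j\<in>UNIV. par_C \<theta> \<bullet> response \<Phi> (\<omega> j) (par_B \<theta> *v column j (G u)))))"
    by (rule choice[THEN exE])
  have "2 ^ card D \<le> (card D * ?d + 2) ^ CARD(('n, 'm) par)"
  proof (rule sign_pattern_bound[OF D(1)])
    show "polyfn ?d (F u)" for u using F' by blast
    fix \<sigma> assume \<sigma>: "\<sigma> \<subseteq> D"
    define g where "g u = (if u \<in> \<sigma> then 1 else 0 :: nat)" for u
    have "g \<in> D \<rightarrow> {0, 1}" by (simp add: g_def)
    then obtain c where "c \<in> sign_concept_class TYPE('n) \<omega>" and cg: "\<And>u. u \<in> D \<Longrightarrow> c u = g u"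
      using sh unfolding shattered_def by blast
    then obtain A :: "real^'n^'n" and B :: "real^'m^'n" and C :: "real^'n^1" and x0
      where c: "c = sign_system \<omega> A B C x0"
      unfolding sign_concept_class_def by blast
    define y where "y u = final_output A B C x0 u" for u
    have y: "0 < y u \<longleftrightarrow> u \<in> \<sigma>" if "u \<in> D" for u
      using cg[OF that] D(2) that by (auto simp: c sign_system_def g_def sign01_def y_def split: if_splits)
    obtain \<Phi> where \<Phi>: "fundamental A \<Phi>" using fundamental_exists by blast
    define \<Psi> where "\<Psi> \<epsilon> t = exp (\<epsilon> * t) *\<^sub>R \<Phi> t" for \<epsilon> t :: real
    define z where "z \<epsilon> u = C $ 1 \<bullet> (\<Psi> \<epsilon> 1 *v x0) + (\<Sum>j\<in>UNIV. C $ 1 \<bullet> response (\<Psi> \<epsilon>) (\<omega> j) (B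
        *v column j (G u)))" for \<epsilon> u
    have row: "(C *v w) $ 1 = C $ 1 \<bullet> w" for w by (simp add: matrix_vector_mult_def inner_vec_def)
    have y_eq: "y u = C $ 1 \<bullet> (\<Phi> 1 *v x0) + (\<Sum>j\<in>UNIV. C $ 1 \<bullet> response \<Phi> (\<omega> j) (B *v column j (G
        u)))" if "u \<in> D" for u
    proof -
      have "y u = final_output A B C x0 (\<lambda>t\<in>{0..1}. G u *v (\<chi> j. \<omega> j t))"
        unfolding y_def by (rule arg_cong[OF G[OF that]])
      also have "\<dots> = C $ 1 \<bullet> (\<Phi> 1 *v x0) + (\<Sum>j\<in>UNIV. C $ 1 \<bullet> response \<Phi> (\<omega> j) (B *v column j (G u)))"
        unfolding row[symmetric] by (rule final_output_response[OF \<Phi> basis_continuous_on[OF \<omega>]])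
      finally show ?thesis .
    qed
    have lim: "((\<lambda>\<epsilon>. z \<epsilon> u) \<longlongrightarrow> y u) (at 0)" if "u \<in> D" for u
    proof -
      have "((\<lambda>\<epsilon>. exp (\<epsilon> * 1) *\<^sub>R \<Phi> 1 *v x0) \<longlongrightarrow> exp (0 * 1) *\<^sub>R \<Phi> 1 *v x0) (at 0)"
        by (intro bounded_bilinear.tendsto[OF bounded_bilinear_matrix_vector_mult] tendsto_intros)
      then show ?thesis
        unfolding z_def \<Psi>_def y_eq[OF that]
        by (intro tendsto_intros response_shift_tendsto[OF \<Phi> basis_continuous_on[OF \<omega>]]) simp
    qed
    define \<eta> where "\<eta> = Min (insert 1 (y ` \<sigma>)) / 2"
    have fin: "finite (insert 1 (y ` \<sigma>))" using D(1) \<sigma> finite_subset by auto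
    have "0 < Min (insert 1 (y ` \<sigma>))" using fin y \<sigma> by (subst Min_gr_iff) auto
    then have \<eta>: "0 < \<eta>" by (simp add: \<eta>_def)
    have \<eta>y: "\<eta> < y u" if "u \<in> \<sigma>" for u
    proof -
      have "Min (insert 1 (y ` \<sigma>)) \<le> y u" using fin that by (intro Min_le) auto
      with \<eta> show ?thesis by (simp add: \<eta>_def)
    qed
    have "eventually (\<lambda>\<epsilon>. \<forall>u\<in>D. (u \<in> \<sigma> \<longrightarrow> \<eta> < z \<epsilon> u) \<and> (u \<notin> \<sigma> \<longrightarrow> z \<epsilon> u < \<eta>)) (at 0)"
    proof (intro eventually_ball_finite D ballI)
      fix u assume u: "u \<in> D"
      show "eventually (\<lambda>\<epsilon>. (u \<in> \<sigma> \<longrightarrow> \<eta> < z \<epsilon> u) \<and> (u \<notin> \<sigma> \<longrightarrow> z \<epsilon> u < \<eta>)) (at 0)"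
      proof (cases "u \<in> \<sigma>")
        case True
        then show ?thesis using order_tendstoD(1)[OF lim[OF u] \<eta>y] by simp
      next
        case False
        then have "y u < \<eta>" using y[OF u] \<eta> by linarith
        with False show ?thesis using order_tendstoD(2)[OF lim[OF u]] by simp
      qed
    qed
    moreover have "eventually (\<lambda>\<epsilon>. \<forall>j\<in>UNIV. det (resonance (\<alpha> j) (\<beta> j) (A + mat \<epsilon>)) \<noteq> 0) (at 0)"
      by (intro eventually_ball_finite ballI det_shift_eventually_nonzero) simp
    ultimately have "eventually (\<lambda>\<epsilon>. (\<forall>u\<in>D. (u \<in> \<sigma> \<longrightarrow> \<eta> < z \<epsilon> u) \<and> (u \<notin> \<sigma> \<longrightarrow> z \<epsilon> u < \<eta>)) \<and>
        (\<forall>j\<in>UNIV. det (resonance (\<alpha> j) (\<beta> j) (A + mat \<epsilon>)) \<noteq> 0)) (at (0::real))"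
      by (rule eventually_conj)
    then obtain \<epsilon> :: real where \<epsilon>: "\<forall>u\<in>D. (u \<in> \<sigma> \<longrightarrow> \<eta> < z \<epsilon> u) \<and> (u \<notin> \<sigma> \<longrightarrow> z \<epsilon> u < \<eta>)"
        "\<forall>j\<in>UNIV. det (resonance (\<alpha> j) (\<beta> j) (A + mat \<epsilon>)) \<noteq> 0"
      using eventually_happens'[OF at_neq_bot] by blast
    obtain \<theta> :: "(real, ('n, 'm) par) vec" where \<theta>: "par_A \<theta> = A + mat \<epsilon>" "par_E \<theta> = \<Psi> \<epsilon> 1" "par_B \<theta> = B"
        "par_C \<theta> = C $ 1" "par_c \<theta> = C $ 1 \<bullet> (\<Psi> \<epsilon> 1 *v x0) - \<eta>"
      using par_surj by metis
    have fund: "fundamental (par_A \<theta>) (\<Psi> \<epsilon>)"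
      unfolding \<theta> \<Psi>_def by (rule fundamental_shift[OF \<Phi>])
    define p where "p = (\<Prod>j\<in>UNIV. det (resonance (\<alpha> j) (\<beta> j) (par_A \<theta>)) ^ (2 * Suc (l j)))"
    have "F u \<theta> = p * (z \<epsilon> u - \<eta>)" for u
      using F'[rule_format, of u, THEN conjunct2, rule_format, OF fund \<theta>(2)[symmetric]]
      by (simp only: p_def \<theta> z_def) (simp add: algebra_simps)
    moreover have "0 < p"
      unfolding p_def \<theta> power_mult
      by (intro prod_pos ballI, rule zero_less_power) (use \<epsilon>(2) in simp)
    ultimately have "\<forall>u\<in>D. (u \<in> \<sigma> \<longrightarrow> 0 < F u \<theta>) \<and> (u \<notin> \<sigma> \<longrightarrow> F u \<theta> < 0)"
      using \<epsilon>(1) by (simp add: zero_less_mult_iff mult_less_0_iff)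
    then show "\<exists>\<theta>. \<forall>u\<in>D. (u \<in> \<sigma> \<longrightarrow> 0 < F u \<theta>) \<and> (u \<notin> \<sigma> \<longrightarrow> F u \<theta> < 0)" by blast
  qed
  also have "CARD(('n, 'm) par) = 2 * CARD('n)\<^sup>2 + CARD('n) * CARD('m) + CARD('n) + 1"
    by (simp add: power2_eq_square)
  finally show ?thesis .
qed

section \<open>The numerical estimate and the VC dimension\<close>

text \<open>
  Write \<open>N = Pz\<close> with \<open>P = 2mn\<^sup>2 + 4n + 1\<close> and let \<open>d\<close> be the degree \<open>8nk(L + 1)\<close>. The hypothesis
  gives \<open>2\<^sup>z \<le> 3dPz\<close>, and \<open>z \<le> 2 \<cdot> 2\<^sup>z\<^sup>/\<^sup>2\<close> turns this into \<open>2\<^sup>z\<^sup>/\<^sup>2 \<le> 6dP\<close>, which is at most the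
  argument of the logarithm.
\<close>

lemma numeric_bound:
  fixes n m k L N :: nat
  assumes n: "1 \<le> n" and m: "1 \<le> m" and k: "1 \<le> k"
    and le: "2 ^ N \<le> (N * (8 * n * k * Suc L) + 2) ^ (2 * n\<^sup>2 + n * m + n + 1)"
  shows "real N \<le> 2 * real (2 * m * n^2 + 4 * n + 1) *
             log 2 (8 * exp 1 * real (8 * m * n^2 * k * (n + L) + 1) * real (2 * n * k + 2 * (1 + 2 * k)^n))"
proof -
  define P where "P = 2 * m * n\<^sup>2 + 4 * n + 1"
  define d where "d = 8 * n * k * Suc L"
  define X where "X = 8 * exp 1 * real (8 * m * n^2 * k * (n + L) + 1) * real (2 * n * k + 2 * (1 + 2 * k)^n)"
  have P1: "1 \<le> P" by (simp add: P_def)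
  have "1 * 1 * 1 * 1 \<le> 8 * n * k * Suc L" using n k by (intro mult_le_mono) auto
  then have d1: "1 \<le> d" by (simp add: d_def)
  have e2: "2 \<le> exp (1::real)" using exp_ge_add_one_self[of 1] by simp
  have sn: "8 * n \<le> 2 * n * k + 2 * (1 + 2 * k) ^ n"
  proof -
    have "1 + real n * 2 \<le> (1 + 2) ^ n" by (rule Bernoulli_inequality) simp
    then have "real (1 + n * 2) \<le> real (3 ^ n)" by simp
    then have "1 + n * 2 \<le> 3 ^ n" by (simp only: of_nat_le_iff)
    moreover have "3 * n \<le> 3 ^ n"
      using n
    proof (induction n rule: dec_induct)
      case (step i)
      then show ?case using power_increasing[of 1 i "3::nat"] by simp
    qed simp
    moreover have "3 ^ n \<le> (1 + 2 * k) ^ n" using k by (intro power_mono) auto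
    moreover have "n * 1 \<le> n * k" using k by (intro mult_le_mono) auto
    ultimately show ?thesis by linarith
  qed
  have main: "6 * d * P \<le> 16 * ((8 * m * n^2 * k * (n + L) + 1) * (2 * n * k + 2 * (1 + 2 * k)^n))"
  proof -
    have n2: "n * 1 \<le> n * n" using n by (intro mult_le_mono) auto
    have "1 * n\<^sup>2 \<le> m * n\<^sup>2" using m by (intro mult_le_mono) auto
    moreover have "n \<le> n\<^sup>2" "1 \<le> n\<^sup>2" using n n2 by (simp_all add: power2_eq_square)
    ultimately have "P \<le> 7 * (m * n\<^sup>2)" unfolding P_def by linarith
    then have "6 * d * P \<le> 6 * (8 * n * k * Suc L) * (7 * (m * n\<^sup>2))" unfolding d_def
        by (intro mult_le_mono) auto
    also have "\<dots> = 336 * (m * n\<^sup>2 * k * Suc L * n)" by (simp add: algebra_simps)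
    also have "\<dots> \<le> 1024 * (m * n\<^sup>2 * k * Suc L * n)" by (intro mult_le_mono) auto
    also have "\<dots> = 16 * ((8 * m * n^2 * k * Suc L) * (8 * n))" by (simp add: algebra_simps)
    also have "\<dots> \<le> 16 * ((8 * m * n^2 * k * (n + L) + 1) * (2 * n * k + 2 * (1 + 2 * k)^n))"
    proof (intro mult_le_mono sn le_refl)
      have "8 * m * n^2 * k * Suc L \<le> 8 * m * n^2 * k * (n + L)" using n by (intro mult_le_mono) auto
      then show "8 * m * n^2 * k * Suc L \<le> 8 * m * n^2 * k * (n + L) + 1" by linarith
    qed
    finally show ?thesis .
  qed
  have "real (6 * d * P) \<le> 16 * (real (8 * m * n^2 * k * (n + L) + 1) * real (2 * n * k + 2 * (1 + 2 * k)^n))"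
    using main by (metis of_nat_le_iff of_nat_mult of_nat_numeral)
  also have "\<dots> \<le> X"
    unfolding X_def using e2 by (simp only: mult.assoc[symmetric]) (intro mult_right_mono; simp)
  finally have X: "6 * real d * real P \<le> X" by simp
  have "1 * 1 \<le> real d * real P" using d1 P1 by (intro mult_mono) auto
  then have X1: "1 \<le> X" using X by linarith
  show ?thesis
  proof (cases "N = 0")
    case True
    have "0 \<le> log 2 X" using X1 by simp
    then show ?thesis using True unfolding X_def by simp
  next
    case False
    define z where "z = real N / real P"
    define w where "w = 2 powr (z / 2)"
    have z0: "0 < z" using False P1 by (simp add: z_def)
    have w0: "0 < w" by (simp add: w_def)
    have pP: "2 * n\<^sup>2 + n * m + n + 1 \<le> P"
    proof -
      obtain m' where m': "m = Suc m'" using m by (cases m) auto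
      have "n * 1 * m' \<le> n * n * m'" using n by (intro mult_le_mono) auto
      then have "m' * n \<le> 2 * (m' * n\<^sup>2)" by (simp add: power2_eq_square mult_ac)
      moreover have "2 * n\<^sup>2 + n * m + n + 1 = 2 * n\<^sup>2 + m' * n + 2 * n + 1" by (simp add: m')
      moreover have "P = 2 * n\<^sup>2 + 2 * (m' * n\<^sup>2) + 4 * n + 1" by (simp add: P_def m' algebra_simps)
      ultimately show ?thesis by linarith
    qed
    have "1 * 1 \<le> N * d" using False d1 by (intro mult_le_mono) auto
    then have "N * d + 2 \<le> 3 * d * N" by simp
    then have "(N * d + 2) ^ (2 * n\<^sup>2 + n * m + n + 1) \<le> (3 * d * N) ^ P"
      using pP by (intro order_trans[OF power_mono power_increasing]) (auto simp: False d1)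
    then have "2 ^ N \<le> (3 * d * N) ^ P" using le by (simp only: d_def)
    then have "real (2 ^ N) \<le> real ((3 * d * N) ^ P)" by (simp only: of_nat_le_iff)
    then have "(2::real) ^ N \<le> real (3 * d * N) ^ P" by simp
    moreover have "(2::real) ^ N = (2 powr z) ^ P"
      using P1 by (simp add: z_def powr_realpow[symmetric] powr_powr)
    ultimately have "(2 powr z) ^ P \<le> real (3 * d * N) ^ P" by simp
    then have "2 powr z \<le> real (3 * d * N)"
      using P1 by (subst (asm) power_mono_iff) auto
    moreover have "2 powr z = w * w" by (simp add: w_def powr_add[symmetric])
    moreover have "real (3 * d * N) = real (3 * d * P) * z" using P1 by (simp add: z_def)
    ultimately have "w * w \<le> real (3 * d * P) * z" by (simp only:)
    then have ww: "w * w \<le> 3 * real d * real P * z" by simp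
    have "z \<le> 2 * w"
    proof -
      have "1 + (z / 2 * ln 2 - 1) \<le> exp (z / 2 * ln 2 - 1)" by (rule exp_ge_add_one_self)
      then have "2 * (z / 2 * ln 2) \<le> exp 1 * exp (z / 2 * ln 2 - 1)"
        using e2 z0 by (intro mult_mono) auto
      also have "\<dots> = w" by (simp add: w_def powr_def exp_diff)
      finally have "z * ln 2 \<le> w" by simp
      moreover have "z * (1 / 2) \<le> z * ln 2"
        using z0 ln2_ge_two_thirds by (intro mult_left_mono) auto
      ultimately show ?thesis by linarith
    qed
    then have "3 * real d * real P * z \<le> 3 * real d * real P * (2 * w)"
      by (intro mult_left_mono) auto
    with ww have "w * w \<le> 3 * real d * real P * (2 * w)" by (rule order_trans)
    then have "w * w \<le> (6 * real d * real P) * w" by simp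
    then have "w \<le> 6 * real d * real P" using w0 by simp
    then have "w \<le> X" using X by linarith
    then have "log 2 w \<le> log 2 X" using w0 by simp
    then have "z / 2 \<le> log 2 X" by (simp add: w_def)
    then have "real N \<le> 2 * real P * log 2 X" using P1 by (simp add: z_def field_simps)
    then show ?thesis by (simp add: P_def X_def)
  qed
qed

lemma shattered_subset:
  assumes "shattered \<C> D" "D' \<subseteq> D"
  shows "shattered \<C> D'"
  unfolding shattered_def
proof
  fix f :: "'a \<Rightarrow> nat" assume f: "f \<in> D' \<rightarrow> {0, 1}"
  have "(\<lambda>u. if u \<in> D' then f u else 0) \<in> D \<rightarrow> {0, 1}"
    using Pi_mem[OF f] by (intro Pi_I) auto
  then have "\<exists>c\<in>\<C>. \<forall>u\<in>D. c u = (if u \<in> D' then f u else 0)"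
    by (rule bspec[OF assms(1)[unfolded shattered_def]])
  then show "\<exists>c\<in>\<C>. \<forall>u\<in>D'. c u = f u"
  proof (rule bexE)
    fix c assume "c \<in> \<C>" "\<forall>u\<in>D. c u = (if u \<in> D' then f u else 0)"
    then show ?thesis using assms(2) by (intro bexI[of _ c]) auto
  qed
qed

lemma vc_dim_le:
  assumes "\<C> \<noteq> {}" and bound: "\<And>D. finite D \<Longrightarrow> D \<subseteq> X \<Longrightarrow> shattered \<C> D \<Longrightarrow> real (card D) \<le> b"
  shows "ereal_of_enat (vc_dim X \<C>) \<le> ereal b"
proof -
  have "shattered \<C> {}" using assms(1) by (auto simp: shattered_def)
  then have b0: "0 \<le> b" using bound[of "{}"] by simp
  have fin: "finite D" if "D \<subseteq> X" "shattered \<C> D" for D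
  proof (rule ccontr)
    assume "infinite D"
    then obtain D' where D': "D' \<subseteq> D" "finite D'" "card D' = Suc (nat \<lfloor>b\<rfloor>)"
      using infinite_arbitrarily_large by blast
    then have "real (Suc (nat \<lfloor>b\<rfloor>)) \<le> b"
      using bound[of D'] shattered_subset[OF that(2), of D'] that(1) by fastforce
    then show False using b0 by linarith
  qed
  have "vc_dim X \<C> \<le> enat (nat \<lfloor>b\<rfloor>)"
    unfolding vc_dim_def
  proof (rule SUP_least)
    fix D assume "D \<in> {D. D \<subseteq> X \<and> shattered \<C> D}"
    then have "finite D" "real (card D) \<le> b" using fin bound by auto
    then show "(if finite D then enat (card D) else \<infinity>) \<le> enat (nat \<lfloor>b\<rfloor>)"
      by (simp add: le_nat_floor)
  qed
  then have "ereal_of_enat (vc_dim X \<C>) \<le> ereal_of_enat (enat (nat \<lfloor>b\<rfloor>))"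
    by (simp only: ereal_of_enat_le_iff)
  also have "\<dots> \<le> ereal b" using b0 by simp
  finally show ?thesis .
qed

theorem theorem3p1:
  fixes l :: "'k::finite \<Rightarrow> nat"
    and \<alpha> \<beta> :: "'k \<Rightarrow> real"
    and \<omega> :: "'k \<Rightarrow> real \<Rightarrow> real"
  assumes "basis_inputs l \<alpha> \<beta> \<omega>"
  shows
    "let n = CARD('n::finite); m = CARD('m::finite); k = CARD('k); lmax = Max (range l)
     in ereal_of_enat
          (vc_dim (input_space \<omega> :: (real \<Rightarrow> real^'m) set) (sign_concept_class TYPE('n) \<omega>))
        \<le> ereal (2 * real (2 * m * n^2 + 4 * n + 1) *
             log 2 (8 * exp 1 * real (8 * m * n^2 * k * (n + lmax) + 1) *
                    real (2 * n * k + 2 * (1 + 2 * k)^n)))"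
  unfolding Let_def
proof (rule vc_dim_le)
  show "(sign_concept_class TYPE('n) \<omega> :: ((real \<Rightarrow> real^'m) \<Rightarrow> nat) set) \<noteq> {}"
    unfolding sign_concept_class_def by blast
  fix D :: "(real \<Rightarrow> real^'m) set"
  assume "finite D" "D \<subseteq> input_space \<omega>" "shattered (sign_concept_class TYPE('n) \<omega>) D"
  from shattered_card_bound[OF assms this]
  show "real (card D) \<le> 2 * real (2 * CARD('m) * CARD('n)^2 + 4 * CARD('n) + 1) *
          log 2 (8 * exp 1 * real (8 * CARD('m) * CARD('n)^2 * CARD('k) * (CARD('n) + Max (range l)) + 1) *
                 real (2 * CARD('n) * CARD('k) + 2 * (1 + 2 * CARD('k))^CARD('n)))"
    by (intro numeric_bound) (simp_all add: Suc_le_eq)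
qed

end
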